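(* For every bipartite graph $G$ and every fractional matching $x$ of $G$, there is a $0.509$-balanced contention resolution scheme for matchings with respect to $x$.
   Context: A fractional matching of $G=(V,E)$ is a point $x\in[0,1]^E$ in the matching polytope of $G$; $x_{uv}$ denotes its coordinate on edge $(u,v)$. $R(x)$ denotes the random edge set in which each edge $e$ appears independently with probability $x_e$. A contention resolution scheme for matchings is a (possibly randomized) procedure that, given $R(x)$, selects a matching $M\subseteq R(x)$; it is $c$-balanced if $\Pr[(u,v)\in M\mid (u,v)\in R(x)]\ge c$ for every edge $(u,v)$ (with $x_{uv}>0$). *)

theory Defs
  imports "HOL-Probability.Probability" "HOL-Probability.Product_PMF"
begin

definition simple_graph :: "'a set \<Rightarrow> 'a set set \<Rightarrow> bool" where
  "simple_graph V E \<longleftrightarrow> finite V \<and> (\<forall>e\<in>E. e \<subseteq> V \<and> card e = 2)"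

definition bipartite_graph :: "'a set \<Rightarrow> 'a set set \<Rightarrow> bool" where
  "bipartite_graph V E \<longleftrightarrow> simple_graph V E \<and>
     (\<exists>A B. A \<union> B = V \<and> A \<inter> B = {} \<and> (\<forall>e\<in>E. \<exists>a\<in>A. \<exists>b\<in>B. e = {a, b}))"

definition matchings :: "'a set set \<Rightarrow> 'a set set set" where
  "matchings E = {M. M \<subseteq> E \<and> pairwise disjnt M}"

text \<open>
  The matching polytope is the convex hull of the incidence vectors of the matchings.  A point of
  \<open>\<real>\<^sup>E\<close> is represented by a function whose values outside \<open>E\<close> are irrelevant; since such
  functions do not form a type of class \<^class>\<open>real_vector\<close>, the convex combinations of the finitely many
  incidence vectors are written out.
\<close>

definition matching_polytope :: "'a set set \<Rightarrow> ('a set \<Rightarrow> real) set" where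
  "matching_polytope E = {x. \<exists>w :: 'a set set \<Rightarrow> real.
     (\<forall>M\<in>matchings E. 0 \<le> w M) \<and> (\<Sum>M\<in>matchings E. w M) = 1 \<and>
     (\<forall>e\<in>E. x e = (\<Sum>M\<in>matchings E. w M * indicator M e))}"

definition fractional_matching :: "'a set set \<Rightarrow> ('a set \<Rightarrow> real) \<Rightarrow> bool" where
  "fractional_matching E x \<longleftrightarrow> (\<forall>e\<in>E. x e \<in> {0..1}) \<and> x \<in> matching_polytope E"

definition random_edges :: "'a set set \<Rightarrow> ('a set \<Rightarrow> real) \<Rightarrow> 'a set set pmf" where
  "random_edges E x = map_pmf (\<lambda>f. {e\<in>E. f e}) (Pi_pmf E False (\<lambda>e. bernoulli_pmf (x e)))"

text \<open>
  A randomized procedure maps every possible outcome of the random edge set to a probability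
  distribution over the selected edge sets.
\<close>

definition contention_resolution_scheme ::
    "'a set set \<Rightarrow> ('a set set \<Rightarrow> 'a set set pmf) \<Rightarrow> bool" where
  "contention_resolution_scheme E \<phi> \<longleftrightarrow> (\<forall>R. R \<subseteq> E \<longrightarrow> set_pmf (\<phi> R) \<subseteq> matchings R)"

definition crs_outcome :: "'a set set \<Rightarrow> ('a set \<Rightarrow> real) \<Rightarrow> ('a set set \<Rightarrow> 'a set set pmf)
    \<Rightarrow> ('a set set \<times> 'a set set) pmf" where
  "crs_outcome E x \<phi> =
     bind_pmf (random_edges E x) (\<lambda>R. map_pmf (\<lambda>M. (R, M)) (\<phi> R))"

definition balanced :: "real \<Rightarrow> 'a set set \<Rightarrow> ('a set \<Rightarrow> real) \<Rightarrow> ('a set set \<Rightarrow> 'a set set pmf)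
    \<Rightarrow> bool" where
  "balanced c E x \<phi> \<longleftrightarrow> (\<forall>e\<in>E. x e > 0 \<longrightarrow>
     \<P>(\<omega> in measure_pmf (crs_outcome E x \<phi>). e \<in> snd \<omega> \<bar> e \<in> fst \<omega>) \<ge> c)"

end

theory Submission
  imports Defs
begin

text \<open>
  Adding loops for the slack at the vertices makes the bipartite double cover of the graph a doubly
  stochastic matrix \<open>X\<close>, and thinning the random edges makes entry \<open>x\<close> present with probability
  \<open>1 - exp (- x)\<close>, so that the other entries of a line are all absent with probability \<open>exp (x - 1)\<close>.
  By Birkhoff's theorem it suffices to allocate to the present entries a substochastic weight.

  A present entry which is the only one of its row (column) is a leaf of its column (row), and leaves have
  priority: a line with leaves shares its capacity among them.  The leaves of a line are independent,
  and they can be thinned to occur with probability \<open>1 - exp (- p * x)\<close> where \<open>p\<close> is close to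
  \<open>1 / e\<close>; a single-item contention resolution scheme then serves each of them with total probability
  \<open>x * (1 - exp (- p))\<close>.  If neither line of an entry has a leaf and both have degree at least 2, the entry gets
  the weight \<open>2 / (deg * deg)\<close>.  The absence of leaves in the row and in the column are increasing events in the
  entries off both lines, so Harris' inequality bounds this late contribution from below by a product.
  Isolated entries are always selected.  The sum of the contributions exceeds \<open>0.509 * x\<close> for all \<open>x\<close>
  in the unit interval.
\<close>

subsection \<open>Random subsets with independent elements\<close>

text \<open>The slack is filled so that the event that the rest of a line is empty has a probability
  depending on x alone; every contribution to an entry is then bounded by a function of x, and the
  claim becomes an inequality in one variable. In the exponential parametrization the rates of
  independent items add: each line has total rate 1 and its leaves have total rate p, whatever the
  entries are. An untreated leaf has probability exp (- 1) * (exp x - 1), which is at least x / e,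
  so deletion can lower it to 1 - exp (- p * x) for every p up to 1 / e. Per unit of x and for x
  tending to 0, the leaf shares give about 0.614, their overlap with isolation costs 0.270,
  isolation gives 0.135 and the late weight 0.042. Without the late weight the sum would stay below
  1 / 2. The sum is least near x = 1 / 3, where it is about 0.510. Two obstacles shape the late
  part. The conditions on the row and on the column read common entries, and reciprocals of degrees
  are not multiplicative over the entries of a line; a geometric lower bound replaces them, so that
  expectations factor.\<close>

definition bexp :: "'i set \<Rightarrow> ('i \<Rightarrow> real) \<Rightarrow> ('i set \<Rightarrow> real) \<Rightarrow> real" where
  "bexp I p f = (\<Sum>S\<in>Pow I. (\<Prod>i\<in>S. p i) * (\<Prod>i\<in>I - S. 1 - p i) * f S)"

lemma bexp_empty [simp]: "bexp {} p f = f {}"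
  by (simp add: bexp_def)

lemma bexp_insert:
  assumes "finite I" "i \<notin> I"
  shows "bexp (insert i I) p f = p i * bexp I p (\<lambda>S. f (insert i S)) + (1 - p i) * bexp I p f"
proof -
  have inj: "inj_on (insert i) (Pow I)"
    using assms(2) by (auto simp: inj_on_def)
  have disj: "Pow I \<inter> insert i ` Pow I = {}"
    using assms(2) by auto
  have "bexp (insert i I) p f =
      (\<Sum>S\<in>Pow I. (\<Prod>i\<in>S. p i) * (\<Prod>i\<in>insert i I - S. 1 - p i) * f S) +
      (\<Sum>S\<in>Pow I. (\<Prod>i\<in>insert i S. p i) * (\<Prod>i\<in>insert i I - insert i S. 1 - p i) * f (insert i S))"
    using assms(1) disj inj
    by (simp add: bexp_def Pow_insert sum.union_disjoint sum.reindex o_def)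
  also have "(\<Sum>S\<in>Pow I. (\<Prod>i\<in>S. p i) * (\<Prod>i\<in>insert i I - S. 1 - p i) * f S) = (1 - p i) * bexp I p f"
    unfolding bexp_def sum_distrib_left
  proof (intro sum.cong refl)
    fix S assume "S \<in> Pow I"
    then have "insert i I - S = insert i (I - S)" using assms(2) by auto
    then show "(\<Prod>i\<in>S. p i) * (\<Prod>i\<in>insert i I - S. 1 - p i) * f S
        = (1 - p i) * ((\<Prod>i\<in>S. p i) * (\<Prod>i\<in>I - S. 1 - p i) * f S)"
      using assms by (simp add: mult_ac)
  qed
  also have "(\<Sum>S\<in>Pow I. (\<Prod>i\<in>insert i S. p i) * (\<Prod>i\<in>insert i I - insert i S. 1 - p i) * f (insert i S))
      = p i * bexp I p (\<lambda>S. f (insert i S))"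
    unfolding bexp_def sum_distrib_left
  proof (intro sum.cong refl)
    fix S assume S: "S \<in> Pow I"
    then have "insert i I - insert i S = I - S" "i \<notin> S" "finite S"
      using assms by (auto intro: finite_subset)
    then show "(\<Prod>i\<in>insert i S. p i) * (\<Prod>i\<in>insert i I - insert i S. 1 - p i) * f (insert i S)
        = p i * ((\<Prod>i\<in>S. p i) * (\<Prod>i\<in>I - S. 1 - p i) * f (insert i S))"
      by (simp add: mult_ac)
  qed
  finally show ?thesis by simp
qed

lemma bexp_cong:
  assumes "I = J" "\<And>i. i \<in> J \<Longrightarrow> p i = q i" "\<And>S. S \<subseteq> J \<Longrightarrow> f S = g S"
  shows "bexp I p f = bexp J q g"
proof -
  have "(\<Prod>i\<in>S. p i) * (\<Prod>i\<in>J - S. 1 - p i) * f S = (\<Prod>i\<in>S. q i) * (\<Prod>i\<in>J - S. 1 - q i) * g S"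
    if "S \<in> Pow J" for S
    using that assms by (intro arg_cong2[where f = "(*)"] prod.cong) auto
  then show ?thesis
    by (simp add: bexp_def assms(1))
qed

lemma bexp_add: "bexp I p (\<lambda>S. f S + g S) = bexp I p f + bexp I p g"
  by (simp add: bexp_def algebra_simps sum.distrib)

lemma bexp_diff: "bexp I p (\<lambda>S. f S - g S) = bexp I p f - bexp I p g"
  by (simp add: bexp_def algebra_simps sum_subtractf)

lemma bexp_cmult: "bexp I p (\<lambda>S. c * f S) = c * bexp I p f"
  by (simp add: bexp_def algebra_simps sum_distrib_left)

lemma bexp_multc: "bexp I p (\<lambda>S. f S * c) = bexp I p f * c"
  using bexp_cmult[of I p c f] by (simp add: mult.commute)

lemma bexp_const: "finite I \<Longrightarrow> bexp I p (\<lambda>S. c) = c"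
  by (induction I rule: finite_induct) (simp_all add: bexp_insert algebra_simps)

lemma bexp_mono:
  assumes "\<And>i. i \<in> I \<Longrightarrow> 0 \<le> p i \<and> p i \<le> 1" "\<And>S. S \<subseteq> I \<Longrightarrow> f S \<le> g S"
  shows "bexp I p f \<le> bexp I p g"
  unfolding bexp_def using assms
  by (intro sum_mono mult_left_mono mult_nonneg_nonneg prod_nonneg) auto

lemma bexp_nonneg:
  assumes "\<And>i. i \<in> I \<Longrightarrow> 0 \<le> p i \<and> p i \<le> 1" "\<And>S. S \<subseteq> I \<Longrightarrow> 0 \<le> f S"
  shows "0 \<le> bexp I p f"
  unfolding bexp_def using assms
  by (intro sum_nonneg mult_nonneg_nonneg prod_nonneg) auto

lemma bexp_Un:
  assumes "finite I" "finite J" "I \<inter> J = {}"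
  shows "bexp (I \<union> J) p f = bexp I p (\<lambda>S. bexp J p (\<lambda>T. f (S \<union> T)))"
  using assms
proof (induction I arbitrary: f rule: finite_induct)
  case (insert i I)
  then show ?case by (simp add: bexp_insert)
qed simp

lemma bexp_marginal:
  assumes "finite J" "I \<subseteq> J" "\<And>S. S \<subseteq> J \<Longrightarrow> f S = g (S \<inter> I)"
  shows "bexp J p f = bexp I p g"
proof -
  have fin: "finite I" "finite (J - I)" using assms by (auto intro: finite_subset)
  have "bexp J p f = bexp (I \<union> (J - I)) p f"
    using assms(2) by (simp add: Un_absorb1)
  also have "\<dots> = bexp I p (\<lambda>S. bexp (J - I) p (\<lambda>T. f (S \<union> T)))"
    using fin by (intro bexp_Un) auto
  also have "\<dots> = bexp I p (\<lambda>S. bexp (J - I) p (\<lambda>T. g S))"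
  proof (intro bexp_cong refl)
    fix S T assume "S \<subseteq> I" "T \<subseteq> J - I"
    then have "S \<union> T \<subseteq> J" "(S \<union> T) \<inter> I = S" using assms(2) by auto
    then show "f (S \<union> T) = g S" using assms(3) by metis
  qed
  also have "\<dots> = bexp I p g" using fin by (simp add: bexp_const)
  finally show ?thesis .
qed

lemma bexp_prod:
  assumes "finite I"
  shows "bexp I p (\<lambda>S. \<Prod>i\<in>I. h i (i \<in> S)) = (\<Prod>i\<in>I. p i * h i True + (1 - p i) * h i False)"
  using assms
proof (induction I rule: finite_induct)
  case (insert i I)
  have *: "bexp I p (\<lambda>S. \<Prod>k\<in>I. h k (k = i \<or> k \<in> S)) = bexp I p (\<lambda>S. \<Prod>k\<in>I. h k (k \<in> S))"
  proof (intro bexp_cong prod.cong refl)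
    fix S k assume "k \<in> I"
    then show "h k (k = i \<or> k \<in> S) = h k (k \<in> S)" using insert.hyps by (cases "k = i") auto
  qed
  have **: "bexp I p (\<lambda>S. h i (i \<in> S) * (\<Prod>k\<in>I. h k (k \<in> S)))
      = bexp I p (\<lambda>S. h i False * (\<Prod>k\<in>I. h k (k \<in> S)))"
  proof (intro bexp_cong refl)
    fix S assume "S \<subseteq> I"
    then have "i \<notin> S" using insert.hyps by auto
    then show "h i (i \<in> S) * (\<Prod>k\<in>I. h k (k \<in> S)) = h i False * (\<Prod>k\<in>I. h k (k \<in> S))" by simp
  qed
  show ?case
    using insert.hyps
    by (simp only: bexp_insert prod.insert bexp_cmult * ** insert.IH insert_iff simp_thms)
      (simp only: distrib_right mult.assoc)
qed simp

lemma bexp_prod_subset: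
  assumes "finite I"
  shows "bexp I p (\<lambda>S. \<Prod>i\<in>S. t i) = (\<Prod>i\<in>I. 1 - p i + p i * t i)"
proof -
  have "bexp I p (\<lambda>S. \<Prod>i\<in>S. t i) = bexp I p (\<lambda>S. \<Prod>i\<in>I. if i \<in> S then t i else 1)"
    using assms by (intro bexp_cong refl) (auto simp: prod.If_cases Int_absorb1)
  also have "\<dots> = (\<Prod>i\<in>I. p i * t i + (1 - p i) * 1)"
    using bexp_prod[OF assms, of p "\<lambda>i b. if b then t i else 1"] by simp
  finally show ?thesis by (simp add: algebra_simps)
qed

text \<open>The indicator is a product with one factor per element, so \<open>bexp_prod\<close>
  applies; elements outside \<open>Y\<close> and \<open>N\<close> contribute the factor 1.\<close>

lemma bexp_cylinder:
  assumes "finite I" "Y \<subseteq> I" "N \<subseteq> I" "Y \<inter> N = {}"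
  shows "bexp I p (\<lambda>S. of_bool (Y \<subseteq> S \<and> S \<inter> N = {})) = (\<Prod>i\<in>Y. p i) * (\<Prod>i\<in>N. 1 - p i)"
proof -
  define h where "h i b = (if i \<in> Y then of_bool b else if i \<in> N then of_bool (\<not> b) else (1::real))" for i b
  have fin: "finite Y" "finite N" using assms by (auto intro: finite_subset)
  have "of_bool (Y \<subseteq> S \<and> S \<inter> N = {}) = (\<Prod>i\<in>I. h i (i \<in> S))" if "S \<subseteq> I" for S
  proof (cases "Y \<subseteq> S \<and> S \<inter> N = {}")
    case True
    then have "\<forall>i\<in>I. h i (i \<in> S) = 1" by (auto simp: h_def)
    then show ?thesis using True by simp
  next
    case False
    then have "\<exists>i\<in>I. h i (i \<in> S) = 0" using assms by (auto simp: h_def)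
    then show ?thesis using False assms(1) by (simp add: prod_zero)
  qed
  then have "bexp I p (\<lambda>S. of_bool (Y \<subseteq> S \<and> S \<inter> N = {})) = (\<Prod>i\<in>I. p i * h i True + (1 - p i) * h i False)"
    unfolding bexp_prod[OF assms(1), symmetric] by (intro bexp_cong refl) auto
  also have "\<dots> = (\<Prod>i\<in>Y \<union> N. p i * h i True + (1 - p i) * h i False)"
    using assms by (intro prod.mono_neutral_right) (auto simp: h_def)
  also have "\<dots> = (\<Prod>i\<in>Y. p i * h i True + (1 - p i) * h i False) * (\<Prod>i\<in>N. p i * h i True + (1 - p i) * h i False)"
    using assms fin by (intro prod.union_disjoint) auto
  also have "\<dots> = (\<Prod>i\<in>Y. p i) * (\<Prod>i\<in>N. 1 - p i)"
    using assms by (intro arg_cong2[where f = "(*)"] prod.cong) (auto simp: h_def)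
  finally show ?thesis .
qed

text \<open>Induction on the ground set. Conditioning on one element leaves Chebyshev's inequality
  for a single coin, whose two conditional means are ordered by monotonicity.\<close>

lemma harris_inequality:
  assumes "finite I" "\<And>i. i \<in> I \<Longrightarrow> 0 \<le> p i \<and> p i \<le> 1"
    and "\<And>S T. S \<subseteq> T \<Longrightarrow> T \<subseteq> I \<Longrightarrow> f S \<le> f T" "\<And>S T. S \<subseteq> T \<Longrightarrow> T \<subseteq> I \<Longrightarrow> g S \<le> g T"
  shows "bexp I p f * bexp I p g \<le> bexp I p (\<lambda>S. f S * g S)"
  using assms
proof (induction I arbitrary: f g rule: finite_induct)
  case (insert i I)
  define f0 f1 g0 g1 where fg: "f0 = bexp I p f" "f1 = bexp I p (\<lambda>S. f (insert i S))"
    "g0 = bexp I p g" "g1 = bexp I p (\<lambda>S. g (insert i S))"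
  have p: "0 \<le> p i" "p i \<le> 1" "\<And>j. j \<in> I \<Longrightarrow> 0 \<le> p j \<and> p j \<le> 1"
    using insert.prems(1) by auto
  have le: "f0 \<le> f1" "g0 \<le> g1"
    unfolding fg using p by (auto intro!: bexp_mono insert.prems(2,3))
  have *: "f0 * g0 \<le> bexp I p (\<lambda>S. f S * g S)" 
    unfolding fg by (rule insert.IH) (use p in \<open>auto intro!: insert.prems(2,3)\<close>)
  have "insert i S \<subseteq> insert i I" if "S \<subseteq> I" for S using that by auto
  then have **: "f1 * g1 \<le> bexp I p (\<lambda>S. f (insert i S) * g (insert i S))"
    unfolding fg using insert.prems p by (intro insert.IH) (auto intro!: insert.prems)
  \<comment> \<open>The covariance over the coin of \<open>i\<close> is
    \<open>p i * (1 - p i) * ((f1 - f0) * (g1 - g0))\<close>, which is nonnegative.\<close>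
  have "(p i * f1 + (1 - p i) * f0) * (p i * g1 + (1 - p i) * g0)
      = p i * (f1 * g1) + (1 - p i) * (f0 * g0) - p i * (1 - p i) * ((f1 - f0) * (g1 - g0))"
    by algebra
  also have "\<dots> \<le> p i * (f1 * g1) + (1 - p i) * (f0 * g0)"
    using p le by simp
  also have "\<dots> \<le> p i * bexp I p (\<lambda>S. f (insert i S) * g (insert i S)) + (1 - p i) * bexp I p (\<lambda>S. f S * g S)"
    using * ** p by (intro add_mono mult_left_mono) auto
  finally show ?case
    using insert.hyps by (simp add: bexp_insert fg)
qed simp

text \<open>Events that read disjoint blocks are independent, so the random set of those that occur
  again has independent elements. The induction splits off one block by \<open>bexp_Un\<close>; that
  block enters only through the truth value of \<open>Q k\<close>.\<close>

lemma bexp_blocks: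
  assumes "finite K" "finite I" "\<And>k. k \<in> K \<Longrightarrow> B k \<subseteq> I" "disjoint_family_on B K"
    and "\<And>k S. k \<in> K \<Longrightarrow> S \<subseteq> I \<Longrightarrow> Q k S = Q k (S \<inter> B k)"
  shows "bexp I p (\<lambda>S. h {k \<in> K. Q k S}) = bexp K (\<lambda>k. bexp I p (\<lambda>S. of_bool (Q k S))) h"
  using assms
proof (induction K arbitrary: I h rule: finite_induct)
  case empty
  then show ?case by (simp add: bexp_const)
next
  case (insert k K)
  have B: "B k \<subseteq> I" "B k \<inter> (I - B k) = {}" "finite (B k)" "finite (I - B k)" "B k \<union> (I - B k) = I"
    using insert.prems by (auto intro: finite_subset)
  have disj: "disjoint_family_on B K" "B j \<inter> B k = {}" if "j \<in> K" for j
    using insert.prems(3) insert.hyps that unfolding disjoint_family_on_def by auto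
  have disj': "disjoint_family_on B K"
    using insert.prems(3) unfolding disjoint_family_on_def by auto
  have Qk: "bexp I p (\<lambda>S. of_bool (Q k S)) = bexp (B k) p (\<lambda>S. of_bool (Q k S))"
    using insert.prems B by (intro bexp_marginal) auto
  have Qj: "bexp I p (\<lambda>S. of_bool (Q j S)) = bexp (I - B k) p (\<lambda>S. of_bool (Q j S))" if "j \<in> K" for j
  proof (rule bexp_marginal)
    fix S assume S: "S \<subseteq> I"
    have "S \<inter> B j = S \<inter> (I - B k) \<inter> B j" using S disj(2)[OF that] by auto
    then show "of_bool (Q j S) = of_bool (Q j (S \<inter> (I - B k)))"
      using insert.prems(4)[of j S] insert.prems(4)[of j "S \<inter> (I - B k)"] that S by auto
  qed (use insert.prems in auto)
  have IH: "bexp (I - B k) p (\<lambda>S. h' {j \<in> K. Q j S}) = bexp K (\<lambda>j. bexp I p (\<lambda>S. of_bool (Q j S))) h'" for h'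
  proof -
    have "bexp (I - B k) p (\<lambda>S. h' {j \<in> K. Q j S}) = bexp K (\<lambda>j. bexp (I - B k) p (\<lambda>S. of_bool (Q j S))) h'"
    proof (rule insert.IH)
      show "B j \<subseteq> I - B k" if "j \<in> K" for j
        using insert.prems(2)[of j] disj(2)[OF that] that by auto
      show "Q j S = Q j (S \<inter> B j)" if "j \<in> K" "S \<subseteq> I - B k" for j S
        using insert.prems(4)[of j S] that by auto
    qed (use insert.prems disj' in auto)
    also have "\<dots> = bexp K (\<lambda>j. bexp I p (\<lambda>S. of_bool (Q j S))) h'"
      by (intro bexp_cong refl Qj[symmetric])
    finally show ?thesis .
  qed
  have eq: "{j \<in> insert k K. Q j (S \<union> T)} = (if Q k S then insert k {j \<in> K. Q j T} else {j \<in> K. Q j T})"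
    if "S \<subseteq> B k" "T \<subseteq> I - B k" for S T
  proof -
    have "(S \<union> T) \<inter> B k = S \<inter> B k" using that by auto
    moreover have "S \<union> T \<subseteq> I" "S \<subseteq> I" using that B(1) by auto
    ultimately have "Q k (S \<union> T) = Q k S"
      using insert.prems(4)[of k "S \<union> T"] insert.prems(4)[of k S] by simp
    moreover have "Q j (S \<union> T) = Q j T" if "j \<in> K" for j
    proof -
      have "(S \<union> T) \<inter> B j = T \<inter> B j" using disj(2)[OF \<open>j \<in> K\<close>] \<open>S \<subseteq> B k\<close> by auto
      then show ?thesis
        using insert.prems(4)[of j "S \<union> T"] insert.prems(4)[of j T] \<open>j \<in> K\<close> \<open>S \<subseteq> B k\<close> \<open>T \<subseteq> I - B k\<close> B(1) by auto
    qed
    ultimately show ?thesis by auto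
  qed
  have "bexp I p (\<lambda>S. h {j \<in> insert k K. Q j S})
      = bexp (B k) p (\<lambda>S. bexp (I - B k) p (\<lambda>T. h {j \<in> insert k K. Q j (S \<union> T)}))"
    using bexp_Un[OF B(3,4,2), of p "\<lambda>S. h {j \<in> insert k K. Q j S}"] B(5) by simp
  also have "\<dots> = bexp (B k) p (\<lambda>S. bexp (I - B k) p (\<lambda>T.
      of_bool (Q k S) * h (insert k {j \<in> K. Q j T}) + (1 - of_bool (Q k S)) * h {j \<in> K. Q j T}))"
    using eq by (intro bexp_cong refl) auto
  also have "\<dots> = bexp (B k) p (\<lambda>S. of_bool (Q k S)) * bexp K (\<lambda>j. bexp I p (\<lambda>S. of_bool (Q j S))) (\<lambda>S. h (insert k S))
     + (1 - bexp (B k) p (\<lambda>S. of_bool (Q k S))) * bexp K (\<lambda>j. bexp I p (\<lambda>S. of_bool (Q j S))) h"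
    using B(3) IH[of "\<lambda>S. h (insert k S)"] IH[of h]
    by (simp only: bexp_add bexp_cmult bexp_multc bexp_diff bexp_const)
  finally show ?case
    using insert.hyps by (simp add: bexp_insert Qk)
qed

text \<open>An element of \<open>I\<close> survives if two independent coins both succeed, an
  element outside \<open>I\<close> if its coin in \<open>T\<close> succeeds. In this way the real
  edges in \<open>R\<close> and the simulated coordinates in \<open>T\<close> merge into one product
  distribution.\<close>

lemma bexp_thin:
  assumes "finite J" "I \<subseteq> J"
  shows "bexp I p (\<lambda>R. bexp J t (\<lambda>T. f (T \<inter> (R \<union> (J - I))))) =
    bexp J (\<lambda>i. if i \<in> I then p i * t i else t i) f"
  using assms
proof (induction J arbitrary: I f rule: finite_induct)
  case (insert j J)
  let ?q = "\<lambda>i. if i \<in> I then p i * t i else t i"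
  show ?case
  proof (cases "j \<in> I")
    case True
    define I' where "I' = I - {j}"
    have I': "I = insert j I'" "j \<notin> I'" "finite I'" "I' \<subseteq> J"
      using True insert.prems insert.hyps by (auto simp: I'_def intro: finite_subset)
    have 1: "insert j T \<inter> (insert j R \<union> (insert j J - insert j I')) = insert j (T \<inter> (R \<union> (J - I')))"
      "T \<inter> (insert j R \<union> (insert j J - insert j I')) = T \<inter> (R \<union> (J - I'))"
      "insert j T \<inter> (R \<union> (insert j J - insert j I')) = T \<inter> (R \<union> (J - I'))"
      "T \<inter> (R \<union> (insert j J - insert j I')) = T \<inter> (R \<union> (J - I'))"
      if "R \<subseteq> I'" "T \<subseteq> J" for R T
      using that I' insert.hyps by auto
    have q: "bexp J ?q f' = bexp J (\<lambda>i. if i \<in> I' then p i * t i else t i) f'" for f'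
      using I' insert.hyps by (intro bexp_cong) auto
    have "bexp I p (\<lambda>R. bexp (insert j J) t (\<lambda>T. f (T \<inter> (R \<union> (insert j J - I)))))
      = p j * bexp I' p (\<lambda>R. t j * bexp J t (\<lambda>T. f (insert j (T \<inter> (R \<union> (J - I'))))) + (1 - t j) * bexp J t (\<lambda>T. f (T \<inter> (R \<union> (J - I')))))
       + (1 - p j) * bexp I' p (\<lambda>R. t j * bexp J t (\<lambda>T. f (T \<inter> (R \<union> (J - I')))) + (1 - t j) * bexp J t (\<lambda>T. f (T \<inter> (R \<union> (J - I')))))"
      unfolding I'(1) bexp_insert[OF I'(3,2)] bexp_insert[OF insert.hyps(1,2)]
      by (intro arg_cong2[where f = "(+)"] arg_cong2[where f = "(*)"] bexp_cong refl) (simp_all only: 1)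
    also have "\<dots> = p j * t j * bexp J (\<lambda>i. if i \<in> I' then p i * t i else t i) (\<lambda>S. f (insert j S))
       + (1 - p j * t j) * bexp J (\<lambda>i. if i \<in> I' then p i * t i else t i) f"
      using insert.IH[OF I'(4), of "\<lambda>S. f (insert j S)"] insert.IH[OF I'(4), of f]
      by (simp add: bexp_add bexp_cmult) (simp add: algebra_simps)
    finally show ?thesis using insert.hyps True by (simp add: bexp_insert q)
  next
    case False
    then have I: "I \<subseteq> J" using insert.prems by auto
    have 1: "insert j T \<inter> (R \<union> (insert j J - I)) = insert j (T \<inter> (R \<union> (J - I)))"
      "T \<inter> (R \<union> (insert j J - I)) = T \<inter> (R \<union> (J - I))" if "R \<subseteq> I" "T \<subseteq> J" for R T
      using that False insert.hyps by auto
    have "bexp I p (\<lambda>R. bexp (insert j J) t (\<lambda>T. f (T \<inter> (R \<union> (insert j J - I)))))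
      = bexp I p (\<lambda>R. t j * bexp J t (\<lambda>T. f (insert j (T \<inter> (R \<union> (J - I))))) + (1 - t j) * bexp J t (\<lambda>T. f (T \<inter> (R \<union> (J - I)))))"
      unfolding bexp_insert[OF insert.hyps(1,2)]
      by (intro arg_cong2[where f = "(+)"] arg_cong2[where f = "(*)"] bexp_cong refl) (simp_all only: 1)
    then show ?thesis
      using insert.hyps False insert.IH[OF I, of "\<lambda>S. f (insert j S)"] insert.IH[OF I, of f]
      by (simp add: bexp_insert bexp_add bexp_cmult)
  qed
qed simp

lemma bexp_reindex:
  assumes "inj_on g I"
  shows "bexp (g ` I) p f = bexp I (p \<circ> g) (\<lambda>S. f (g ` S))"
proof -
  have inj: "inj_on ((`) g) (Pow I)" using assms by (rule inj_on_image_Pow)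
  have "bexp (g ` I) p f = (\<Sum>S\<in>Pow I. (\<Prod>i\<in>g ` S. p i) * (\<Prod>i\<in>g ` I - g ` S. 1 - p i) * f (g ` S))"
    unfolding bexp_def image_Pow_surj[OF refl, symmetric] by (simp add: sum.reindex[OF inj] o_def)
  also have "\<dots> = bexp I (p \<circ> g) (\<lambda>S. f (g ` S))"
    unfolding bexp_def
  proof (intro sum.cong refl)
    fix S assume S: "S \<in> Pow I"
    then have "inj_on g S" "inj_on g (I - S)" "g ` I - g ` S = g ` (I - S)"
      using assms by (auto intro: inj_on_subset simp: inj_on_image_set_diff)
    then show "(\<Prod>i\<in>g ` S. p i) * (\<Prod>i\<in>g ` I - g ` S. 1 - p i) * f (g ` S)
       = (\<Prod>i\<in>S. (p \<circ> g) i) * (\<Prod>i\<in>I - S. 1 - (p \<circ> g) i) * f (g ` S)"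
      by (simp add: prod.reindex)
  qed
  finally show ?thesis .
qed

text \<open>The shape of \<open>random_edges\<close>, for an arbitrary index set. Its expectations
  are the polynomials \<open>bexp\<close> in p, whose algebra above needs no integrability.\<close>

definition rset_pmf :: "'i set \<Rightarrow> ('i \<Rightarrow> real) \<Rightarrow> 'i set pmf" where
  "rset_pmf I p = map_pmf (\<lambda>f. {i \<in> I. f i}) (Pi_pmf I False (\<lambda>i. bernoulli_pmf (p i)))"

lemma set_rset_pmf: "set_pmf (rset_pmf I p) \<subseteq> Pow I"
  by (auto simp: rset_pmf_def)

lemma rset_pmf_insert:
  assumes "finite I" "i \<notin> I"
  shows "rset_pmf (insert i I) p =
    bind_pmf (bernoulli_pmf (p i)) (\<lambda>b. map_pmf (\<lambda>S. if b then insert i S else S) (rset_pmf I p))"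
proof -
  have "rset_pmf (insert i I) p = 
    bind_pmf (bernoulli_pmf (p i)) (\<lambda>b. bind_pmf (Pi_pmf I False (\<lambda>i. bernoulli_pmf (p i)))
       (\<lambda>f. return_pmf {j \<in> insert i I. (f(i := b)) j}))"
    unfolding rset_pmf_def using assms
    by (simp add: Pi_pmf_insert pair_pmf_def map_bind_pmf map_pmf_def bind_assoc_pmf bind_return_pmf)
  also have "\<dots> = bind_pmf (bernoulli_pmf (p i)) (\<lambda>b. map_pmf (\<lambda>S. if b then insert i S else S) (rset_pmf I p))"
    unfolding rset_pmf_def map_pmf_comp map_pmf_def bind_assoc_pmf bind_return_pmf
    using assms by (intro bind_pmf_cong refl arg_cong[where f = return_pmf]) auto
  finally show ?thesis .
qed

lemma expectation_rset_pmf: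
  assumes "finite I" "\<And>i. i \<in> I \<Longrightarrow> 0 \<le> p i \<and> p i \<le> 1"
  shows "measure_pmf.expectation (rset_pmf I p) f = bexp I p f"
  using assms
proof (induction I arbitrary: f rule: finite_induct)
  case empty
  then show ?case by (simp add: rset_pmf_def)
next
  case (insert i I)
  have fin: "finite (set_pmf (rset_pmf I p))"
    using finite_subset[OF set_rset_pmf[of I p]] insert.hyps(1) by simp
  have "measure_pmf.expectation (rset_pmf (insert i I) p) f
     = measure_pmf.expectation (bernoulli_pmf (p i)) (\<lambda>b. measure_pmf.expectation (map_pmf (\<lambda>S. if b then insert i S else S) (rset_pmf I p)) f)"
    unfolding rset_pmf_insert[OF insert.hyps]
    by (subst pmf_expectation_bind[of UNIV])
      (auto simp: fin integral_measure_pmf[of UNIV] UNIV_bool)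
  also have "\<dots> = p i * bexp I p (\<lambda>S. f (insert i S)) + (1 - p i) * bexp I p f"
    using insert.prems by (subst integral_bernoulli_pmf) (auto simp: insert.IH)
  finally show ?case using insert.hyps by (simp add: bexp_insert)
qed

subsection \<open>Birkhoff's theorem for substochastic matrices\<close>

text \<open>Gaussian elimination: an equation with a nonzero coefficient at \<open>f\<close> removes
  itself and the unknown \<open>f\<close>, which preserves the strict inequality of the
  cardinalities.\<close>

lemma homogeneous_system:
  fixes c :: "'t \<Rightarrow> 'e \<Rightarrow> real"
  assumes "finite T" "finite F" "card T < card F"
  shows "\<exists>d. (\<exists>e\<in>F. d e \<noteq> 0) \<and> (\<forall>t\<in>T. (\<Sum>e\<in>F. c t e * d e) = 0)"
  using assms
proof (induction T arbitrary: F c rule: finite_induct)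
  case empty
  then obtain e where "e \<in> F" by fastforce
  then show ?case by (intro exI[of _ "\<lambda>_. 1"]) auto
next
  case (insert t T)
  show ?case
  proof (cases "\<forall>e\<in>F. c t e = 0")
    case True
    have "card T < card F" using insert by auto
    with insert.IH insert.prems(1) obtain d where
      "\<exists>e\<in>F. d e \<noteq> 0" "\<forall>t\<in>T. (\<Sum>e\<in>F. c t e * d e) = 0" by blast
    then show ?thesis using True by (intro exI[of _ d]) auto
  next
    case False
    then obtain f where f: "f \<in> F" "c t f \<noteq> 0" by blast
    define F' where "F' = F - {f}"
    have F': "F = insert f F'" "f \<notin> F'" "finite F'" using f insert.prems by (auto simp: F'_def)
    have "card T < card F'" using insert.prems insert.hyps F' by auto
    then obtain d where d: "\<exists>e\<in>F'. d e \<noteq> 0"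
      "\<forall>s\<in>T. (\<Sum>e\<in>F'. (c s e - c s f * c t e / c t f) * d e) = 0"
      using insert.IH[OF F'(3), of "\<lambda>s e. c s e - c s f * c t e / c t f"] by blast
    \<comment> \<open>Back-substitution: the value at \<open>f\<close> is forced by equation
      \<open>t\<close>.\<close>
    define d' where "d' = d(f := - (\<Sum>e\<in>F'. c t e * d e) / c t f)"
    have *: "(\<Sum>e\<in>F. c s e * d' e) = (\<Sum>e\<in>F'. c s e * d e) - c s f * (\<Sum>e\<in>F'. c t e * d e) / c t f" for s
    proof -
      have "(\<Sum>e\<in>F'. c s e * d' e) = (\<Sum>e\<in>F'. c s e * d e)"
        using F' by (intro sum.cong) (auto simp: d'_def)
      then show ?thesis using F' by (simp add: d'_def)
    qed
    have "(\<Sum>e\<in>F. c s e * d' e) = 0" if "s \<in> T" for s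
    proof -
      have "0 = (\<Sum>e\<in>F'. c s e * d e - c s f / c t f * (c t e * d e))"
        using d(2) that by (simp add: algebra_simps)
      also have "\<dots> = (\<Sum>e\<in>F. c s e * d' e)"
        unfolding * sum_subtractf sum_distrib_left[symmetric] by simp
      finally show ?thesis by simp
    qed
    moreover have "(\<Sum>e\<in>F. c t e * d' e) = 0" unfolding * using f by simp
    moreover have "\<exists>e\<in>F. d' e \<noteq> 0" using d(1) F' by (auto simp: d'_def)
    ultimately show ?thesis by (intro exI[of _ d']) auto
  qed
qed

text \<open>Ratio test: t is the first time at which a decreasing coordinate reaches 0. Coordinates
  that vanish at the start do not move, so this time is positive.\<close>

lemma slack_line:
  fixes s m :: "'k \<Rightarrow> real"
  assumes "finite K" "\<And>k. k \<in> K \<Longrightarrow> 0 \<le> s k" "\<And>k. k \<in> K \<Longrightarrow> s k = 0 \<Longrightarrow> m k = 0" "\<exists>k\<in>K. m k < 0"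
  shows "\<exists>t>0. (\<forall>k\<in>K. 0 \<le> s k + t * m k) \<and> (\<exists>k\<in>K. 0 < s k \<and> s k + t * m k = 0)"
proof -
  define N where "N = {k \<in> K. m k < 0}"
  define t where "t = Min ((\<lambda>k. s k / - m k) ` N)"
  have N: "finite N" "N \<noteq> {}" using assms by (auto simp: N_def)
  have "t \<in> (\<lambda>k. s k / - m k) ` N" unfolding t_def using N by (intro Min_in) auto
  then obtain k where k: "k \<in> N" "t = s k / - m k" by blast
  have kk: "k \<in> K" "m k < 0" "0 < s k"
    using k assms(2,3)[of k] by (auto simp: N_def order_less_le)
  have "0 < t" unfolding k(2) using kk by (intro divide_pos_pos) auto
  moreover have "0 \<le> s j + t * m j" if "j \<in> K" for j
  proof (cases "m j < 0")
    case True
    then have "t \<le> s j / - m j" unfolding t_def using N that by (intro Min_le) (auto simp: N_def)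
    with True show ?thesis by (simp add: field_simps)
  next
    case False
    with assms(2)[OF that] \<open>0 < t\<close> show ?thesis by simp
  qed
  moreover have "s k + t * m k = 0" using k(2) kk by simp
  ultimately show ?thesis using kk by blast
qed

definition substochastic :: "'a set \<Rightarrow> 'b set \<Rightarrow> ('a \<Rightarrow> 'b \<Rightarrow> real) \<Rightarrow> bool" where
  "substochastic A B y \<longleftrightarrow> (\<forall>i\<in>A. \<forall>j\<in>B. 0 \<le> y i j) \<and>
     (\<forall>i\<in>A. (\<Sum>j\<in>B. y i j) \<le> 1) \<and> (\<forall>j\<in>B. (\<Sum>i\<in>A. y i j) \<le> 1)"

definition bimatching :: "('a \<times> 'b) set \<Rightarrow> bool" where
  "bimatching M \<longleftrightarrow> inj_on fst M \<and> inj_on snd M"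

definition support :: "'a set \<Rightarrow> 'b set \<Rightarrow> ('a \<Rightarrow> 'b \<Rightarrow> real) \<Rightarrow> ('a \<times> 'b) set" where
  "support A B y = {(i, j) \<in> A \<times> B. y i j \<noteq> 0}"

text \<open>A tight line with an entry strictly between 0 and 1 has at least two of them.  So there are at most as many
  such lines as such entries, and in the case of equality one of the line conditions is redundant.\<close>

lemma substochastic_direction:
  assumes fin: "finite A" "finite B" and y: "substochastic A B y"
    and frac: "\<exists>i\<in>A. \<exists>j\<in>B. y i j \<noteq> 0 \<and> y i j \<noteq> 1"
  shows "\<exists>d. (\<exists>i\<in>A. \<exists>j\<in>B. d i j \<noteq> 0) \<and> (\<forall>i\<in>A. \<forall>j\<in>B. y i j = 0 \<longrightarrow> d i j = 0) \<and>
    (\<forall>i\<in>A. (\<Sum>j\<in>B. y i j) = 1 \<longrightarrow> (\<Sum>j\<in>B. d i j) = 0) \<and>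
    (\<forall>j\<in>B. (\<Sum>i\<in>A. y i j) = 1 \<longrightarrow> (\<Sum>i\<in>A. d i j) = (0::real))"
proof -
  define F where "F = {(i, j) \<in> A \<times> B. y i j \<noteq> 0 \<and> y i j \<noteq> 1}"
  define rF where "rF i = {j \<in> B. (i, j) \<in> F}" for i
  define cF where "cF j = {i \<in> A. (i, j) \<in> F}" for j
  define P where "P = {i \<in> A. rF i \<noteq> {} \<and> (\<Sum>j\<in>B. y i j) = 1}"
  define Q where "Q = {j \<in> B. cF j \<noteq> {} \<and> (\<Sum>i\<in>A. y i j) = 1}"
  have finF: "finite F" using fin by (auto simp: F_def intro: finite_subset[of _ "A \<times> B"])
  have finPQ: "finite P" "finite Q" using fin by (auto simp: P_def Q_def)
  have finrc: "finite (rF i)" "finite (cF j)" for i j using fin by (auto simp: rF_def cF_def)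
  have y0: "0 \<le> y i j" if "i \<in> A" "j \<in> B" for i j using y that by (auto simp: substochastic_def)
  have two: "2 \<le> card {k \<in> K. f k \<noteq> 0 \<and> f k \<noteq> 1}"
    if "finite K" "(\<Sum>k\<in>K. f k) = 1" "\<forall>k\<in>K. 0 \<le> f k" "k \<in> K" "f k \<noteq> 0" "f k \<noteq> 1"
    for K :: "'c set" and f :: "'c \<Rightarrow> real" and k
  proof -
    have le: "f l \<le> 1" if "l \<in> K" for l
      using member_le_sum[of l K f] that \<open>finite K\<close> \<open>(\<Sum>k\<in>K. f k) = 1\<close> \<open>\<forall>k\<in>K. 0 \<le> f k\<close> by auto
    have s: "(\<Sum>l\<in>K - {k}. f l) = 1 - f k"
      using that sum.remove[of K k f] by simp
    have "\<exists>l\<in>K - {k}. f l \<noteq> 0"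
    proof (rule ccontr)
      assume "\<not> ?thesis"
      then have "(\<Sum>l\<in>K - {k}. f l) = 0" by (intro sum.neutral) auto
      with s that show False by simp
    qed
    then obtain l where l: "l \<in> K - {k}" "f l \<noteq> 0" by blast
    have "f l \<le> 1 - f k"
      using member_le_sum[of l "K - {k}" f] l that s by auto
    moreover have "0 < f k" using that by (auto simp: order_less_le)
    ultimately have "f l \<noteq> 1" by auto
    then have "{k, l} \<subseteq> {k \<in> K. f k \<noteq> 0 \<and> f k \<noteq> 1}" using l that by auto
    then have "card {k, l} \<le> card {k \<in> K. f k \<noteq> 0 \<and> f k \<noteq> 1}" using that by (intro card_mono) auto
    then show ?thesis using l by (simp add: card_insert_if split: if_splits)
  qed
  have deg: "2 \<le> card (rF i)" if "i \<in> P" for i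
  proof -
    have i: "i \<in> A" "(\<Sum>j\<in>B. y i j) = 1" and "rF i \<noteq> {}" using that by (auto simp: P_def)
    then obtain j where "j \<in> rF i" by blast
    then have "j \<in> B" "y i j \<noteq> 0" "y i j \<noteq> 1" by (auto simp: rF_def F_def)
    with i have "2 \<le> card {j \<in> B. y i j \<noteq> 0 \<and> y i j \<noteq> 1}" using two[of B "y i" j] fin y0 by auto
    also have "{j \<in> B. y i j \<noteq> 0 \<and> y i j \<noteq> 1} = rF i" using i by (auto simp: rF_def F_def)
    finally show ?thesis .
  qed
  have deg': "2 \<le> card (cF j)" if "j \<in> Q" for j
  proof -
    have i: "j \<in> B" "(\<Sum>i\<in>A. y i j) = 1" and "cF j \<noteq> {}" using that by (auto simp: Q_def)
    then obtain i where "i \<in> cF j" by blast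
    then have "i \<in> A" "y i j \<noteq> 0" "y i j \<noteq> 1" by (auto simp: cF_def F_def)
    with i have "2 \<le> card {i \<in> A. y i j \<noteq> 0 \<and> y i j \<noteq> 1}" using two[of A "\<lambda>i. y i j" i] fin y0 by auto
    also have "{i \<in> A. y i j \<noteq> 0 \<and> y i j \<noteq> 1} = cF j" using i by (auto simp: cF_def F_def)
    finally show ?thesis .
  qed
  have SP: "card (SIGMA i:P. rF i) = (\<Sum>i\<in>P. card (rF i))" using finPQ finrc by (intro card_SigmaI) auto
  have SQ: "card (SIGMA j:Q. cF j) = (\<Sum>j\<in>Q. card (cF j))" using finPQ finrc by (intro card_SigmaI) auto
  have P2: "2 * card P \<le> card (SIGMA i:P. rF i)"
    unfolding SP using sum_mono[of P "\<lambda>_. 2" "\<lambda>i. card (rF i)"] deg by simp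
  have Q2: "2 * card Q \<le> card (prod.swap ` (SIGMA j:Q. cF j))"
    unfolding card_image[OF inj_on_subset[OF inj_swap subset_UNIV]] SQ
    using sum_mono[of Q "\<lambda>_. 2" "\<lambda>i. card (cF i)"] deg' by simp
  have PF: "(SIGMA i:P. rF i) \<subseteq> F" and QF: "prod.swap ` (SIGMA j:Q. cF j) \<subseteq> F"
    by (auto simp: rF_def cF_def)
  have PF': "card (SIGMA i:P. rF i) \<le> card F" and QF': "card (prod.swap ` (SIGMA j:Q. cF j)) \<le> card F"
    using finF PF QF by (auto intro: card_mono)
  define c :: "'a + 'b \<Rightarrow> 'a \<times> 'b \<Rightarrow> real" where
    "c t e = (case t of Inl i \<Rightarrow> of_bool (fst e = i) | Inr j \<Rightarrow> of_bool (snd e = j))" for t e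
  have cl: "(\<Sum>e\<in>F. c (Inl i) e * d e) = (\<Sum>j\<in>B. if (i, j) \<in> F then d (i, j) else 0)"
    if "i \<in> A" for i and d :: "'a \<times> 'b \<Rightarrow> real"
  proof -
    have "(\<Sum>e\<in>F. c (Inl i) e * d e) = (\<Sum>e\<in>A \<times> B. c (Inl i) e * (if e \<in> F then d e else 0))"
      using fin by (intro sum.mono_neutral_cong_left) (auto simp: F_def)
    also have "\<dots> = (\<Sum>i'\<in>A. \<Sum>j\<in>B. of_bool (i' = i) * (if (i', j) \<in> F then d (i', j) else 0))"
      unfolding sum.cartesian_product by (intro sum.cong) (auto simp: c_def)
    also have "\<dots> = (\<Sum>j\<in>B. if (i, j) \<in> F then d (i, j) else 0)"
      using fin that by (subst sum.swap)
        (simp add: sum.delta of_bool_def if_distrib[of "\<lambda>x. x * _"] cong: if_cong)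
    finally show ?thesis .
  qed
  have cr: "(\<Sum>e\<in>F. c (Inr j) e * d e) = (\<Sum>i\<in>A. if (i, j) \<in> F then d (i, j) else 0)"
    if "j \<in> B" for j and d :: "'a \<times> 'b \<Rightarrow> real"
  proof -
    have "(\<Sum>e\<in>F. c (Inr j) e * d e) = (\<Sum>e\<in>A \<times> B. c (Inr j) e * (if e \<in> F then d e else 0))"
      using fin by (intro sum.mono_neutral_cong_left) (auto simp: F_def)
    also have "\<dots> = (\<Sum>i\<in>A. \<Sum>j'\<in>B. if j' = j then (if (i, j') \<in> F then d (i, j') else 0) else 0)"
      unfolding sum.cartesian_product by (intro sum.cong) (auto simp: c_def)
    also have "\<dots> = (\<Sum>i\<in>A. if (i, j) \<in> F then d (i, j) else 0)"
      using fin that by (simp add: sum.delta)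
    finally show ?thesis .
  qed
  have "\<exists>d. (\<exists>e\<in>F. d e \<noteq> 0) \<and> (\<forall>t\<in>Inl ` P \<union> Inr ` Q. (\<Sum>e\<in>F. c t e * d e) = 0)"
  proof (cases "card P + card Q < card F")
    case True
    have "card (Inl ` P \<union> Inr ` Q) = card P + card Q"
      using finPQ by (subst card_Un_disjoint) (auto simp: card_image)
    then show ?thesis using True finPQ finF by (intro homogeneous_system) auto
  next
    case False
    then have "card (SIGMA i:P. rF i) = card F" "card (prod.swap ` (SIGMA j:Q. cF j)) = card F"
      and eq: "card P + card Q = card F"
      using P2 Q2 PF' QF' by linarith+
    then have FP: "(SIGMA i:P. rF i) = F" and FQ: "prod.swap ` (SIGMA j:Q. cF j) = F"
      using card_subset_eq[OF finF PF] card_subset_eq[OF finF QF] by simp_all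
    obtain e where "e \<in> F" using frac by (auto simp: F_def)
    \<comment> \<open>Every fractional entry lies in a tight row and in a tight column here. Hence
      the row equations and the column equations have the same sum, namely that of \<open>d\<close>
      over \<open>F\<close>, and the equation of row \<open>i0\<close> follows from all the
      others.\<close>
    then obtain i0 where i0: "i0 \<in> P" using FP by blast
    have "card (Inl ` (P - {i0}) \<union> Inr ` Q) = card (P - {i0}) + card Q"
      using finPQ by (subst card_Un_disjoint) (auto simp: card_image)
    also have "\<dots> < card F" using eq i0 finPQ by (metis add_less_cancel_right card_Diff1_less)
    finally have "\<exists>d. (\<exists>e\<in>F. d e \<noteq> 0) \<and> (\<forall>t\<in>Inl ` (P - {i0}) \<union> Inr ` Q. (\<Sum>e\<in>F. c t e * d e) = 0)"
      using finPQ finF by (intro homogeneous_system) auto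
    then obtain d where d: "\<exists>e\<in>F. d e \<noteq> 0" "\<forall>t\<in>Inl ` (P - {i0}) \<union> Inr ` Q. (\<Sum>e\<in>F. c t e * d e) = 0"
      by blast
    have "(\<Sum>i\<in>P. \<Sum>e\<in>F. c (Inl i) e * d e) = (\<Sum>e\<in>F. d e)"
    proof (subst sum.swap, intro sum.cong refl)
      fix e assume "e \<in> F"
      then have "fst e \<in> P" using FP by auto
      then show "(\<Sum>i\<in>P. c (Inl i) e * d e) = d e"
        using finPQ by (simp add: c_def sum_distrib_right[symmetric] of_bool_def sum.delta)
    qed
    moreover have "(\<Sum>j\<in>Q. \<Sum>e\<in>F. c (Inr j) e * d e) = (\<Sum>e\<in>F. d e)"
    proof (subst sum.swap, intro sum.cong refl)
      fix e assume "e \<in> F"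
      then have "snd e \<in> Q" using FQ by auto
      then show "(\<Sum>j\<in>Q. c (Inr j) e * d e) = d e"
        using finPQ by (simp add: c_def sum_distrib_right[symmetric] of_bool_def sum.delta)
    qed
    moreover have "(\<Sum>j\<in>Q. \<Sum>e\<in>F. c (Inr j) e * d e) = 0" using d(2) by (intro sum.neutral) auto
    moreover have "(\<Sum>i\<in>P. \<Sum>e\<in>F. c (Inl i) e * d e) = (\<Sum>e\<in>F. c (Inl i0) e * d e)"
      using d(2) finPQ i0 by (subst sum.remove[of _ i0]) auto
    ultimately have "(\<Sum>e\<in>F. c (Inl i0) e * d e) = 0" by simp
    with d show ?thesis by (intro exI[of _ d]) auto
  qed
  then obtain d where d: "\<exists>e\<in>F. d e \<noteq> 0" "\<forall>t\<in>Inl ` P \<union> Inr ` Q. (\<Sum>e\<in>F. c t e * d e) = 0" by blast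
  define d' where "d' i j = (if (i, j) \<in> F then d (i, j) else 0)" for i j
  have "(\<Sum>j\<in>B. d' i j) = 0" if "i \<in> A" "(\<Sum>j\<in>B. y i j) = 1" for i
  proof (cases "rF i = {}")
    case True
    then have "\<forall>j\<in>B. d' i j = 0" by (auto simp: rF_def d'_def)
    then show ?thesis by simp
  next
    case False
    then have "Inl i \<in> Inl ` P \<union> Inr ` Q" using that by (auto simp: P_def)
    then show ?thesis using d(2) cl[OF that(1), of d] unfolding d'_def by metis
  qed
  moreover have "(\<Sum>i\<in>A. d' i j) = 0" if "j \<in> B" "(\<Sum>i\<in>A. y i j) = 1" for j
  proof (cases "cF j = {}")
    case True
    then have "\<forall>i\<in>A. d' i j = 0" by (auto simp: cF_def d'_def)
    then show ?thesis by simp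
  next
    case False
    then have "Inr j \<in> Inl ` P \<union> Inr ` Q" using that by (auto simp: Q_def)
    then show ?thesis using d(2) cr[OF that(1), of d] unfolding d'_def by metis
  qed
  moreover have "\<exists>i\<in>A. \<exists>j\<in>B. d' i j \<noteq> 0" using d(1) by (force simp: d'_def F_def)
  moreover have "\<forall>i\<in>A. \<forall>j\<in>B. y i j = 0 \<longrightarrow> d' i j = 0" by (auto simp: d'_def F_def)
  ultimately show ?thesis by (intro exI[of _ d']) auto
qed


text \<open>Entries, rows and columns form one index type, so that \<open>slack_line\<close> treats
  all constraints alike. The number of nonzero slacks is the induction measure for Birkhoff's
  theorem.\<close>

definition slack :: "'a set \<Rightarrow> 'b set \<Rightarrow> ('a \<Rightarrow> 'b \<Rightarrow> real) \<Rightarrow> ('a \<times> 'b) + ('a + 'b) \<Rightarrow> real" where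
  "slack A B y k = (case k of Inl (i, j) \<Rightarrow> y i j | Inr (Inl i) \<Rightarrow> 1 - (\<Sum>j\<in>B. y i j)
     | Inr (Inr j) \<Rightarrow> 1 - (\<Sum>i\<in>A. y i j))"

abbreviation constraints :: "'a set \<Rightarrow> 'b set \<Rightarrow> (('a \<times> 'b) + ('a + 'b)) set" where
  "constraints A B \<equiv> (A \<times> B) <+> (A <+> B)"

lemma substochastic_slack: "substochastic A B y \<longleftrightarrow> (\<forall>k\<in>constraints A B. 0 \<le> slack A B y k)"
proof -
  have "(\<forall>k\<in>constraints A B. P k) \<longleftrightarrow>
      (\<forall>i\<in>A. \<forall>j\<in>B. P (Inl (i, j))) \<and> (\<forall>i\<in>A. P (Inr (Inl i))) \<and> (\<forall>j\<in>B. P (Inr (Inr j)))" for P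
    by blast
  then show ?thesis by (simp add: substochastic_def slack_def)
qed

text \<open>Along \<open>d\<close> every slack is affine with slope \<open>m\<close>. Tight
  constraints have slope 0 and stay tight, and the ratio test makes one further constraint
  tight.\<close>

lemma substochastic_step:
  assumes fin: "finite A" "finite B" and y: "substochastic A B y"
    and d: "\<exists>i\<in>A. \<exists>j\<in>B. d i j \<noteq> 0" "\<forall>i\<in>A. \<forall>j\<in>B. y i j = 0 \<longrightarrow> d i j = 0"
    "\<forall>i\<in>A. (\<Sum>j\<in>B. y i j) = 1 \<longrightarrow> (\<Sum>j\<in>B. d i j) = 0"
    "\<forall>j\<in>B. (\<Sum>i\<in>A. y i j) = 1 \<longrightarrow> (\<Sum>i\<in>A. d i j) = (0::real)"
  shows "\<exists>t>0. substochastic A B (\<lambda>i j. y i j + t * d i j) \<and>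
    support A B (\<lambda>i j. y i j + t * d i j) \<subseteq> support A B y \<and>
    card {k \<in> constraints A B. slack A B (\<lambda>i j. y i j + t * d i j) k \<noteq> 0}
      < card {k \<in> constraints A B. slack A B y k \<noteq> 0}"
proof -
  define m where "m k = (case k of Inl (i, j) \<Rightarrow> d i j | Inr (Inl i) \<Rightarrow> - (\<Sum>j\<in>B. d i j)
     | Inr (Inr j) \<Rightarrow> - (\<Sum>i\<in>A. d i j))" for k
  have line: "slack A B (\<lambda>i j. y i j + t * d i j) k = slack A B y k + t * m k" for t k
    by (auto simp: slack_def m_def sum.distrib sum_distrib_left[symmetric] algebra_simps split: sum.splits)
  have tight: "m k = 0" if "k \<in> constraints A B" "slack A B y k = 0" for k
    using that d(2-4) by (auto simp: slack_def m_def)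
  \<comment> \<open>The motion must hit a constraint: if no entry decreases, then some row sum
    increases and the slack of that row shrinks.\<close>
  have neg: "\<exists>k\<in>constraints A B. m k < 0"
  proof (cases "\<exists>i\<in>A. \<exists>j\<in>B. d i j < 0")
    case True
    then obtain i j where "i \<in> A" "j \<in> B" "d i j < 0" by blast
    then show ?thesis by (intro bexI[of _ "Inl (i, j)"]) (auto simp: m_def)
  next
    case False
    then have pos: "\<forall>i\<in>A. \<forall>j\<in>B. 0 \<le> d i j" by force
    obtain i j where ij: "i \<in> A" "j \<in> B" "d i j \<noteq> 0" using d(1) by blast
    have "0 < (\<Sum>j\<in>B. d i j)" using ij pos fin by (intro sum_pos2[of B j]) (auto simp: order_less_le)
    then show ?thesis using ij by (intro bexI[of _ "Inr (Inl i)"]) (auto simp: m_def)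
  qed
  have fink: "finite (constraints A B)" using fin by auto
  have "\<exists>t>0. (\<forall>k\<in>constraints A B. 0 \<le> slack A B y k + t * m k) \<and>
      (\<exists>k\<in>constraints A B. 0 < slack A B y k \<and> slack A B y k + t * m k = 0)"
    using y fink tight neg unfolding substochastic_slack by (intro slack_line) auto
  then obtain t k where t: "0 < t" "\<forall>k\<in>constraints A B. 0 \<le> slack A B y k + t * m k"
    and k: "k \<in> constraints A B" "0 < slack A B y k" "slack A B y k + t * m k = 0" by blast
  have "{k \<in> constraints A B. slack A B (\<lambda>i j. y i j + t * d i j) k \<noteq> 0}
      \<subset> {k \<in> constraints A B. slack A B y k \<noteq> 0}"
    using k tight unfolding line by fastforce
  then have "card {k \<in> constraints A B. slack A B (\<lambda>i j. y i j + t * d i j) k \<noteq> 0}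
      < card {k \<in> constraints A B. slack A B y k \<noteq> 0}"
    using fink by (intro psubset_card_mono) auto
  moreover have "substochastic A B (\<lambda>i j. y i j + t * d i j)"
    unfolding substochastic_slack line by (rule t(2))
  moreover have "support A B (\<lambda>i j. y i j + t * d i j) \<subseteq> support A B y"
    using d(2) by (auto simp: support_def)
  ultimately show ?thesis using t(1) by blast
qed

lemma integral_bimatching:
  assumes fin: "finite A" "finite B" and y: "substochastic A B y"
    and int: "\<forall>i\<in>A. \<forall>j\<in>B. y i j = 0 \<or> y i j = 1"
  shows "bimatching (support A B y)"
proof -
  have row: "j = j'" if "(i, j) \<in> support A B y" "(i, j') \<in> support A B y" for i j j'
  proof (rule ccontr)
    assume "j \<noteq> j'"
    moreover have "y i j = 1" "y i j' = 1" using that int by (auto simp: support_def)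
    ultimately have "(\<Sum>l\<in>{j, j'}. y i l) = 2" by simp
    moreover have "(\<Sum>l\<in>{j, j'}. y i l) \<le> (\<Sum>l\<in>B. y i l)"
      using that y fin by (intro sum_mono2) (auto simp: support_def substochastic_def)
    ultimately show False using y that by (force simp: support_def substochastic_def)
  qed
  have col: "i = i'" if "(i, j) \<in> support A B y" "(i', j) \<in> support A B y" for i i' j
  proof (rule ccontr)
    assume "i \<noteq> i'"
    moreover have "y i j = 1" "y i' j = 1" using that int by (auto simp: support_def)
    ultimately have "(\<Sum>l\<in>{i, i'}. y l j) = 2" by simp
    moreover have "(\<Sum>l\<in>{i, i'}. y l j) \<le> (\<Sum>l\<in>A. y l j)"
      using that y fin by (intro sum_mono2) (auto simp: support_def substochastic_def)
    ultimately show False using y that by (force simp: support_def substochastic_def)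
  qed
  show ?thesis unfolding bimatching_def inj_on_def using row col by (auto; metis)
qed

lemma prob_bind_pmf:
  "measure_pmf.prob (bind_pmf p f) {x. Q x} = measure_pmf.expectation p (\<lambda>y. measure_pmf.prob (f y) {x. Q x})"
proof -
  have *: "measure_pmf.prob q {x. Q x} = pmf (map_pmf Q q) True" for q
    by (simp add: pmf_map vimage_def)
  show ?thesis unfolding * map_bind_pmf pmf_bind ..
qed

text \<open>A fractional matrix is pushed in both directions along the same line until a new
  constraint becomes tight. Both end points have fewer nonzero slacks, and a mixture of their
  distributions represents the matrix.\<close>

theorem birkhoff_substochastic:
  assumes "finite A" "finite B" "substochastic A B y"
  shows "\<exists>\<mu>. (\<forall>M\<in>set_pmf \<mu>. bimatching M \<and> M \<subseteq> support A B y) \<and>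
    (\<forall>i\<in>A. \<forall>j\<in>B. measure_pmf.prob \<mu> {M. (i, j) \<in> M} = y i j)"
  using assms(3)
proof (induction "card {k \<in> constraints A B. slack A B y k \<noteq> 0}" arbitrary: y rule: less_induct)
  case less
  note y = less.prems
  show ?case
  proof (cases "\<exists>i\<in>A. \<exists>j\<in>B. y i j \<noteq> 0 \<and> y i j \<noteq> 1")
    case False
    then have int: "\<forall>i\<in>A. \<forall>j\<in>B. y i j = 0 \<or> y i j = 1" by blast
    have "measure_pmf.prob (return_pmf (support A B y)) {M. (i, j) \<in> M} = y i j" if "i \<in> A" "j \<in> B" for i j
    proof -
      have "y i j = 0 \<or> y i j = 1" using that int by blast
      then show ?thesis using that by (auto simp: support_def)
    qed
    then show ?thesis
      using integral_bimatching[OF assms(1,2) y int] by (intro exI[of _ "return_pmf (support A B y)"]) auto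
  next
    case True
    obtain d where d: "\<exists>i\<in>A. \<exists>j\<in>B. d i j \<noteq> 0" "\<forall>i\<in>A. \<forall>j\<in>B. y i j = 0 \<longrightarrow> d i j = 0"
      "\<forall>i\<in>A. (\<Sum>j\<in>B. y i j) = 1 \<longrightarrow> (\<Sum>j\<in>B. d i j) = 0"
      "\<forall>j\<in>B. (\<Sum>i\<in>A. y i j) = 1 \<longrightarrow> (\<Sum>i\<in>A. d i j) = (0::real)"
      using substochastic_direction[OF assms(1,2) y True] by blast
    obtain t where t: "0 < t" "substochastic A B (\<lambda>i j. y i j + t * d i j)"
      "support A B (\<lambda>i j. y i j + t * d i j) \<subseteq> support A B y"
      "card {k \<in> constraints A B. slack A B (\<lambda>i j. y i j + t * d i j) k \<noteq> 0}
      < card {k \<in> constraints A B. slack A B y k \<noteq> 0}"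
      using substochastic_step[OF assms(1,2) y d] by blast
    have "\<exists>u>0. substochastic A B (\<lambda>i j. y i j + u * (- d i j)) \<and>
        support A B (\<lambda>i j. y i j + u * (- d i j)) \<subseteq> support A B y \<and>
        card {k \<in> constraints A B. slack A B (\<lambda>i j. y i j + u * (- d i j)) k \<noteq> 0}
          < card {k \<in> constraints A B. slack A B y k \<noteq> 0}"
      using d by (intro substochastic_step[OF assms(1,2) y]) (auto simp: sum_negf)
    then obtain u where u: "0 < u" "substochastic A B (\<lambda>i j. y i j + u * (- d i j))"
      "support A B (\<lambda>i j. y i j + u * (- d i j)) \<subseteq> support A B y"
      "card {k \<in> constraints A B. slack A B (\<lambda>i j. y i j + u * (- d i j)) k \<noteq> 0}
      < card {k \<in> constraints A B. slack A B y k \<noteq> 0}"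
      by blast
    obtain \<mu> where \<mu>: "\<forall>M\<in>set_pmf \<mu>. bimatching M \<and> M \<subseteq> support A B (\<lambda>i j. y i j + t * d i j)"
      "\<forall>i\<in>A. \<forall>j\<in>B. measure_pmf.prob \<mu> {M. (i, j) \<in> M} = y i j + t * d i j"
      using less.hyps[OF t(4,2)] by blast
    obtain \<nu> where \<nu>: "\<forall>M\<in>set_pmf \<nu>. bimatching M \<and> M \<subseteq> support A B (\<lambda>i j. y i j + u * (- d i j))"
      "\<forall>i\<in>A. \<forall>j\<in>B. measure_pmf.prob \<nu> {M. (i, j) \<in> M} = y i j + u * (- d i j)"
      using less.hyps[OF u(4,2)] by blast
    \<comment> \<open>The weight at which the displacements \<open>t * d\<close> and
      \<open>- u * d\<close> cancel in the mean.\<close>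
    define p where "p = u / (t + u)"
    have p: "0 \<le> p" "p \<le> 1" "p * t = (1 - p) * u" using t(1) u(1) by (auto simp: p_def field_simps)
    define \<rho> where "\<rho> = bind_pmf (bernoulli_pmf p) (\<lambda>b. if b then \<mu> else \<nu>)"
    have "measure_pmf.prob \<rho> {M. (i, j) \<in> M} = y i j" if "i \<in> A" "j \<in> B" for i j
    proof -
      have "measure_pmf.prob \<rho> {M. (i, j) \<in> M} = p * (y i j + t * d i j) + (1 - p) * (y i j + u * (- d i j))"
        unfolding \<rho>_def prob_bind_pmf using \<mu>(2) \<nu>(2) that p
        by (subst integral_bernoulli_pmf) auto
      also have "\<dots> = y i j + (p * t - (1 - p) * u) * d i j" by algebra
      finally show ?thesis using p by simp
    qed
    moreover have "\<forall>M\<in>set_pmf \<rho>. bimatching M \<and> M \<subseteq> support A B y"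
    proof
      fix M assume "M \<in> set_pmf \<rho>"
      then have "M \<in> set_pmf \<mu> \<or> M \<in> set_pmf \<nu>" by (auto simp: \<rho>_def split: if_splits)
      then show "bimatching M \<and> M \<subseteq> support A B y" using \<mu>(1) \<nu>(1) t(3) u(3) by blast
    qed
    ultimately show ?thesis by blast
  qed
qed

subsection \<open>Contention resolution for a single item\<close>

text \<open>With total rate z some item is present with probability 1 - exp (- z); this is that
  probability per unit of rate, extended continuously to z = 0.\<close>

definition pick_rate :: "real \<Rightarrow> real" where
  "pick_rate z = (if z = 0 then 1 else (1 - exp (- z)) / z)"

text \<open>The item \<open>i\<close> has rate \<open>l i\<close>. The demanded probabilities add up
  to the probability that some item is present, so they use up exactly what is available.\<close>

definition is_item_scheme :: "'i set \<Rightarrow> ('i \<Rightarrow> real) \<Rightarrow> ('i set \<Rightarrow> 'i \<Rightarrow> real) \<Rightarrow> bool" where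
  "is_item_scheme I l r \<longleftrightarrow> (\<forall>S\<subseteq>I. \<forall>i. 0 \<le> r S i \<and> (i \<notin> S \<longrightarrow> r S i = 0)) \<and>
     (\<forall>S\<subseteq>I. S \<noteq> {} \<longrightarrow> (\<Sum>i\<in>I. r S i) = 1) \<and>
     (\<forall>i\<in>I. bexp I (\<lambda>i. 1 - exp (- l i)) (\<lambda>S. r S i) = l i * pick_rate (\<Sum>i\<in>I. l i))"

lemma bexp_of_bool_empty:
  assumes "finite I"
  shows "bexp I p (\<lambda>S. of_bool (S = {})) = (\<Prod>i\<in>I. 1 - p i)"
proof -
  have "bexp I p (\<lambda>S. of_bool (S = {})) = bexp I p (\<lambda>S. of_bool ({} \<subseteq> S \<and> S \<inter> I = {}))"
    by (intro bexp_cong refl) (auto simp: of_bool_def)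
  then show ?thesis using bexp_cylinder[OF assms, of "{}" I p] by simp
qed

text \<open>A new item of rate \<open>l\<close> joins items of total rate \<open>L\<close>: it wins
  outright if it is alone, and otherwise with probability \<open>\<theta>\<close>. The two equations
  give the new item and each old one the ratio of the merged rate.\<close>

lemma merge_rates:
  fixes L l :: real
  assumes "0 \<le> L" "0 \<le> l"
  shows "\<exists>\<theta>. 0 \<le> \<theta> \<and> \<theta> \<le> 1 \<and>
    (1 - exp (- l)) * (\<theta> + (1 - \<theta>) * exp (- L)) = l * pick_rate (L + l) \<and>
    (L = 0 \<or> pick_rate L * (1 - (1 - exp (- l)) * \<theta>) = pick_rate (L + l))"
proof (cases "L = 0 \<or> l = 0")
  case True
  then show ?thesis by (intro exI[of _ 0]) (auto simp: pick_rate_def)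
next
  case False
  then have pos: "0 < L" "0 < l" using assms by auto
  define a c where ac: "a = exp (- L)" "c = exp (- l)"
  have ac01: "0 < a" "a < 1" "0 < c" "c < 1" using pos by (auto simp: ac)
  have exp_sum: "exp (- (L + l)) = a * c" by (simp add: ac exp_add[symmetric])
  define g where "g = (1 - a * c) / (L + l)"
  have gs: "g * (L + l) = 1 - a * c" using pos by (simp add: g_def)
  \<comment> \<open>Solves the first equation. After multiplication by \<open>L + l\<close>, the
    bounds on \<open>\<theta>\<close> become \<open>(1 - c) * (a * L) \<le> l * (1 - a)\<close> and
    \<open>(l * c) * (1 - a) \<le> (1 - c) * L\<close>.\<close>
  define \<theta> where "\<theta> = (l * g / (1 - c) - a) / (1 - a)"
  have bounds: "1 - c \<le> l" "1 - a \<le> L" using exp_ge_add_one_self[of "- l"] exp_ge_add_one_self[of "- L"] by (auto simp: ac)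
  have "a * exp L = 1" "c * exp l = 1" by (auto simp: ac exp_minus)
  then have bounds': "a * L \<le> 1 - a" "l * c \<le> 1 - c"
    using mult_left_mono[OF exp_ge_add_one_self[of L], of a] mult_left_mono[OF exp_ge_add_one_self[of l], of c] ac01
    by (auto simp: algebra_simps)
  have "(1 - c) * (a * L) \<le> l * (1 - a)" using bounds bounds' ac01 pos by (intro mult_mono) auto
  then have "a * (1 - c) * (L + l) \<le> l * g * (L + l)" unfolding mult.assoc gs by (simp add: algebra_simps)
  then have "a * (1 - c) \<le> l * g" using pos by simp
  then have "a \<le> l * g / (1 - c)" using ac01 by (simp add: pos_le_divide_eq)
  then have t0: "0 \<le> \<theta>" using ac01 by (simp add: \<theta>_def)
  have "(l * c) * (1 - a) \<le> (1 - c) * L" using bounds bounds' ac01 pos by (intro mult_mono) auto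
  then have "l * g * (L + l) \<le> (1 - c) * (L + l)" unfolding mult.assoc gs by (simp add: algebra_simps)
  then have "l * g \<le> 1 - c" using pos by simp
  then have "l * g / (1 - c) \<le> 1" using ac01 by (simp add: pos_divide_le_eq)
  then have t1: "\<theta> \<le> 1" unfolding \<theta>_def using ac01 by (subst pos_divide_le_eq) auto
  have th: "(1 - a) * ((1 - c) * \<theta>) = l * g - (1 - c) * a"
  proof -
    have "(1 - a) * \<theta> = l * g / (1 - c) - a" "(1 - c) * (l * g / (1 - c)) = l * g"
      using ac01 by (simp_all add: \<theta>_def)
    then show ?thesis by algebra
  qed
  have e1: "(1 - c) * (\<theta> + (1 - \<theta>) * a) = l * g" using th by algebra
  \<comment> \<open>Conservation: of the total \<open>g * (L + l)\<close> the new item takes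
    \<open>l * g\<close>, and the old ones keep the rest.\<close>
  have "(1 - a) * (1 - (1 - c) * \<theta>) = g * L" using th gs by algebra
  then have e2: "(1 - a) / L * (1 - (1 - c) * \<theta>) = g" using pos by (simp add: field_simps)
  have "pick_rate (L + l) = g" "pick_rate L = (1 - a) / L"
    using pos unfolding pick_rate_def exp_sum g_def by (simp_all add: ac)
  then show ?thesis
    using t0 t1 e1 e2 by (intro exI[of _ \<theta>]) (simp add: ac[symmetric])
qed

text \<open>A new item wins against the others with the probability \<open>\<theta>\<close> that keeps all the ratios equal.\<close>

lemma item_scheme_exists:
  assumes "finite I" "\<And>i. i \<in> I \<Longrightarrow> 0 \<le> l i"
  shows "\<exists>r. is_item_scheme I l r"
  using assms
proof (induction I rule: finite_induct)
  case empty
  then show ?case by (intro exI[of _ "\<lambda>_ _. 0"]) (simp add: is_item_scheme_def)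
next
  case (insert n I)
  define L where "L = (\<Sum>i\<in>I. l i)"
  let ?p = "\<lambda>i. 1 - exp (- l i)"
  obtain r where r: "is_item_scheme I l r" using insert by auto
  have "0 \<le> L" unfolding L_def using insert.prems by (intro sum_nonneg) auto
  then obtain \<theta> where th: "0 \<le> \<theta>" "\<theta> \<le> 1"
    "?p n * (\<theta> + (1 - \<theta>) * exp (- L)) = l n * pick_rate (L + l n)"
    "L = 0 \<or> pick_rate L * (1 - ?p n * \<theta>) = pick_rate (L + l n)"
    using merge_rates[of L "l n"] insert.prems by auto
  define r' where "r' S i =
    (if n \<notin> S then r S i else if S = {n} then of_bool (i = n) else if i = n then \<theta> else (1 - \<theta>) * r (S - {n}) i)"
    for S i
  have S: "S \<subseteq> I" if "S \<subseteq> insert n I" "n \<notin> S" for S using that by auto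
  have S': "S - {n} \<subseteq> I" "S \<noteq> {n} \<Longrightarrow> n \<in> S \<Longrightarrow> S - {n} \<noteq> {}" if "S \<subseteq> insert n I" for S using that by auto
  have "0 \<le> r' S i \<and> (i \<notin> S \<longrightarrow> r' S i = 0)" if "S \<subseteq> insert n I" for S i
    using r th S S' that unfolding r'_def is_item_scheme_def by auto
  moreover have "(\<Sum>i\<in>insert n I. r' S i) = 1" if "S \<subseteq> insert n I" "S \<noteq> {}" for S
  proof -
    consider "n \<notin> S" | "S = {n}" | "n \<in> S" "S \<noteq> {n}" by blast
    then show ?thesis
    proof cases
      case 1
      then show ?thesis using r S that insert.hyps by (simp add: r'_def is_item_scheme_def)
    next
      case 2
      then have "(\<Sum>i\<in>I. r' S i) = 0" using insert.hyps by (intro sum.neutral) (auto simp: r'_def)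
      then show ?thesis using 2 insert.hyps by (simp add: r'_def)
    next
      case 3
      then have "(\<Sum>i\<in>I. r' S i) = (\<Sum>i\<in>I. (1 - \<theta>) * r (S - {n}) i)"
        using insert.hyps by (intro sum.cong) (auto simp: r'_def)
      also have "\<dots> = 1 - \<theta>"
        using r S'[OF that(1)] 3 by (simp add: sum_distrib_left[symmetric] is_item_scheme_def)
      finally show ?thesis using 3 insert.hyps by (simp add: r'_def)
    qed
  qed
  moreover have "bexp (insert n I) ?p (\<lambda>S. r' S i) = l i * pick_rate (\<Sum>i\<in>insert n I. l i)"
    if "i \<in> insert n I" for i
  proof (cases "i = n")
    case True
    have "bexp I ?p (\<lambda>S. r' S n) = bexp I ?p (\<lambda>S. 0)"
      using insert.hyps r by (intro bexp_cong refl) (auto simp: r'_def is_item_scheme_def)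
    moreover have "bexp I ?p (\<lambda>S. r' (insert n S) n) = bexp I ?p (\<lambda>S. \<theta> + (1 - \<theta>) * of_bool (S = {}))"
      using insert.hyps by (intro bexp_cong refl) (auto simp: r'_def)
    moreover have "(\<Prod>i\<in>I. 1 - ?p i) = exp (- L)"
      using insert.hyps by (simp add: L_def sum_negf[symmetric] exp_sum)
    ultimately have "bexp (insert n I) ?p (\<lambda>S. r' S n) = ?p n * (\<theta> + (1 - \<theta>) * exp (- L))"
      using insert.hyps by (simp add: bexp_insert bexp_const bexp_add bexp_cmult bexp_of_bool_empty)
    then show ?thesis using th True insert.hyps by (simp add: L_def add.commute)
  next
    case False
    then have i: "i \<in> I" using that by auto
    have E: "bexp I ?p (\<lambda>S. r S i) = l i * pick_rate L" using r i by (simp add: is_item_scheme_def L_def)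
    have "bexp I ?p (\<lambda>S. r' S i) = bexp I ?p (\<lambda>S. r S i)"
      using insert.hyps by (intro bexp_cong refl) (auto simp: r'_def)
    moreover have "bexp I ?p (\<lambda>S. r' (insert n S) i) = bexp I ?p (\<lambda>S. (1 - \<theta>) * r S i)"
    proof (intro bexp_cong refl)
      fix S assume S: "S \<subseteq> I"
      then have "n \<notin> S" "S = {} \<Longrightarrow> r S i = 0" using insert.hyps r by (auto simp: is_item_scheme_def)
      then show "r' (insert n S) i = (1 - \<theta>) * r S i"
        using False by (cases "S = {}") (auto simp: r'_def)
    qed
    ultimately have "bexp (insert n I) ?p (\<lambda>S. r' S i) = l i * (pick_rate L * (1 - ?p n * \<theta>))"
      using insert.hyps by (simp add: bexp_insert bexp_cmult E) (simp add: algebra_simps)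
    also have "\<dots> = l i * pick_rate (L + l n)"
    \<comment> \<open>If \<open>L = 0\<close>, the rate of \<open>i\<close> vanishes and both sides
      are 0; this is the case in which \<open>merge_rates\<close> gives no second equation.\<close>
    proof (cases "L = 0")
      case True
      then have "l i = 0" using i insert.hyps insert.prems by (auto simp: L_def sum_nonneg_eq_0_iff)
      then show ?thesis by simp
    qed (use th in simp)
    finally show ?thesis using insert.hyps by (simp add: L_def add.commute)
  qed
  ultimately show ?case unfolding is_item_scheme_def by (intro exI[of _ r']) auto
qed

text \<open>Item \<open>k\<close> occurs when \<open>Y k\<close> is present and \<open>N k\<close>
  is absent. Disjoint coordinates make the items independent, and \<open>prob\<close> matches their
  probabilities with the rates of the scheme.\<close>

lemma bexp_item_scheme_cylinders:
  assumes fin: "finite K" "finite I" and r: "is_item_scheme K l r"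
    and sub: "\<And>k. k \<in> K \<Longrightarrow> Y k \<subseteq> I \<and> N k \<subseteq> I \<and> Y k \<inter> N k = {}"
    and disj: "disjoint_family_on (\<lambda>k. Y k \<union> N k) K"
    and prob: "\<And>k. k \<in> K \<Longrightarrow> (\<Prod>i\<in>Y k. w i) * (\<Prod>i\<in>N k. 1 - w i) = 1 - exp (- l k)"
    and a: "a \<in> K"
  shows "bexp I w (\<lambda>S. r {k \<in> K. Y k \<subseteq> S \<and> S \<inter> N k = {}} a) = l a * pick_rate (\<Sum>k\<in>K. l k)"
proof -
  have "bexp I w (\<lambda>S. r {k \<in> K. Y k \<subseteq> S \<and> S \<inter> N k = {}} a)
     = bexp K (\<lambda>k. bexp I w (\<lambda>S. of_bool (Y k \<subseteq> S \<and> S \<inter> N k = {}))) (\<lambda>Z. r Z a)"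
  proof (rule bexp_blocks[OF fin _ disj])
    show "(Y k \<subseteq> S \<and> S \<inter> N k = {}) = (Y k \<subseteq> S \<inter> (Y k \<union> N k) \<and> S \<inter> (Y k \<union> N k) \<inter> N k = {})"
      if "k \<in> K" "S \<subseteq> I" for k S by auto
  qed (use sub in auto)
  also have "\<dots> = bexp K (\<lambda>k. 1 - exp (- l k)) (\<lambda>Z. r Z a)"
    using bexp_cylinder[OF fin(2)] sub prob by (intro bexp_cong) auto
  also have "\<dots> = l a * pick_rate (\<Sum>k\<in>K. l k)" using r a by (simp add: is_item_scheme_def)
  finally show ?thesis .
qed

subsection \<open>Leaf priority in a doubly stochastic matrix\<close>

text \<open>A present entry fails to be a leaf when its veto or another entry of its line occurs,
  that is, when its set \<open>N k\<close> is hit.\<close>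

lemma bexp_hit_all:
  assumes "finite I" "finite J" "\<And>k. k \<in> J \<Longrightarrow> N k \<subseteq> I" "disjoint_family_on N J"
  shows "bexp I w (\<lambda>T. of_bool (\<forall>k\<in>J. T \<inter> N k \<noteq> {})) = (\<Prod>k\<in>J. 1 - (\<Prod>n\<in>N k. 1 - w n))"
proof -
  have "bexp I w (\<lambda>T. of_bool (\<forall>k\<in>J. T \<inter> N k \<noteq> {})) = bexp I w (\<lambda>T. of_bool ({k \<in> J. T \<inter> N k = {}} = {}))"
    by (intro bexp_cong refl) (auto simp: of_bool_def)
  also have "\<dots> = bexp J (\<lambda>k. bexp I w (\<lambda>T. of_bool (T \<inter> N k = {}))) (\<lambda>Z. of_bool (Z = {}))"
    using assms by (intro bexp_blocks[where B = N]) auto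
  also have "\<dots> = (\<Prod>k\<in>J. 1 - bexp I w (\<lambda>T. of_bool (T \<inter> N k = {})))"
    by (rule bexp_of_bool_empty) fact
  also have "\<dots> = (\<Prod>k\<in>J. 1 - (\<Prod>n\<in>N k. 1 - w n))"
    using bexp_cylinder[of I "{}" _ w] assms by (intro prod.cong) simp_all
  finally show ?thesis .
qed

text \<open>For \<open>J\<close> the other present entries of a line and \<open>m k\<close> the
  probability that a present \<open>k\<close> is no leaf, \<open>w k * m k\<close> is the
  probability of being present but no leaf. The geometric weight makes the expectation a product of
  factors \<open>exp (- x k) / 3 + 2 / 3 * exp (- p * x k)\<close>, and convexity bounds each by one
  exponential; the term of the empty \<open>J\<close> is subtracted.\<close>

lemma bexp_nonempty_geometric:
  assumes "finite K" "\<And>k. k \<in> K \<Longrightarrow> w k = 1 - exp (- x k)"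
    and "\<And>k. k \<in> K \<Longrightarrow> w k * m k = exp (- p * x k) - exp (- x k)"
  shows "exp (- (1 + 2 * p) / 3 * (\<Sum>k\<in>K. x k)) - exp (- (\<Sum>k\<in>K. x k))
    \<le> bexp K w (\<lambda>J. of_bool (J \<noteq> {}) * (2 / 3) ^ card J * (\<Prod>k\<in>J. m k))"
proof -
  have "bexp K w (\<lambda>J. of_bool (J \<noteq> {}) * (2 / 3) ^ card J * (\<Prod>k\<in>J. m k))
      = bexp K w (\<lambda>J. (\<Prod>k\<in>J. 2 / 3 * m k) - of_bool (J = {}))"
    by (intro bexp_cong refl) (simp only: prod.distrib prod_constant, simp add: of_bool_def)
  also have "\<dots> = (\<Prod>k\<in>K. 1 - w k + w k * (2 / 3 * m k)) - (\<Prod>k\<in>K. 1 - w k)"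
    using assms(1) by (simp add: bexp_diff bexp_prod_subset bexp_of_bool_empty)
  also have "(\<Prod>k\<in>K. 1 - w k) = exp (- (\<Sum>k\<in>K. x k))"
    using assms(1,2) by (simp add: sum_negf[symmetric] exp_sum)
  finally have eq: "bexp K w (\<lambda>J. of_bool (J \<noteq> {}) * (2 / 3) ^ card J * (\<Prod>k\<in>J. m k))
      = (\<Prod>k\<in>K. 1 - w k + w k * (2 / 3 * m k)) - exp (- (\<Sum>k\<in>K. x k))" .
  have "exp (- (1 + 2 * p) / 3 * (\<Sum>k\<in>K. x k)) = (\<Prod>k\<in>K. exp (- (1 + 2 * p) / 3 * x k))"
    using assms(1) by (simp add: sum_distrib_left exp_sum)
  also have "\<dots> \<le> (\<Prod>k\<in>K. 1 - w k + w k * (2 / 3 * m k))"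
  proof (intro prod_mono conjI)
    fix k assume k: "k \<in> K"
    define c where "c = - (1 + 2 * p) / 3 * x k"
    \<comment> \<open>\<open>c\<close> is the mean of \<open>- x k\<close> and
      \<open>- p * x k\<close> with weights 1 / 3 and 2 / 3, so the tangent at \<open>c\<close>
      yields Jensen's inequality.\<close>
    have tangent: "exp c * (1 + (u - c)) \<le> exp u" for u
      using mult_left_mono[OF exp_ge_add_one_self[of "u - c"], of "exp c"] by (simp add: exp_add[symmetric])
    have "exp c = exp c * (1 + (- x k - c)) / 3 + 2 / 3 * (exp c * (1 + (- p * x k - c)))"
      by (simp add: c_def field_simps)
    also have "\<dots> \<le> exp (- x k) / 3 + 2 / 3 * exp (- p * x k)"
      using tangent[of "- x k"] tangent[of "- p * x k"] by simp
    also have "\<dots> = 1 - w k + w k * (2 / 3 * m k)"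
      using assms(2,3)[OF k] by (simp add: algebra_simps)
    finally show "exp (- (1 + 2 * p) / 3 * x k) \<le> 1 - w k + w k * (2 / 3 * m k)" by (simp add: c_def)
  qed simp
  finally show ?thesis using eq by simp
qed

text \<open>Equality holds at n = 1 and n = 2, which determines both 3 / 4 and 2 / 3; from then on
  the right-hand side decays more slowly.\<close>

lemma geometric_le_inverse_Suc:
  assumes "1 \<le> n"
  shows "3 / 4 * (2 / 3) ^ n \<le> 1 / real (Suc n)"
  using assms
proof (induction n rule: dec_induct)
  case (step n)
  have "3 / 4 * (2 / 3) ^ Suc n = 2 / 3 * (3 / 4 * (2 / 3 :: real) ^ n)" by simp
  also have "\<dots> \<le> 2 / 3 * (1 / real (Suc n))" by (intro mult_left_mono step.IH) simp
  also have "\<dots> \<le> 1 / real (Suc (Suc n))" using step.hyps by (simp add: field_simps)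
  finally show ?case .
qed simp

type_synonym ('a, 'b) idx = "nat \<times> 'a \<times> 'b"

text \<open>A small entry x is alone in its row with probability about x / e; \<open>p_le\<close>
  lets vetoes reduce this to the rate \<open>p * x\<close>.\<close>

locale leaf_scheme =
  fixes A :: "'a set" and B :: "'b set" and X :: "'a \<Rightarrow> 'b \<Rightarrow> real" and p :: real
  assumes finA: "finite A" and finB: "finite B"
    and X_nonneg: "\<And>i j. i \<in> A \<Longrightarrow> j \<in> B \<Longrightarrow> 0 \<le> X i j"
    and X_row: "\<And>i. i \<in> A \<Longrightarrow> (\<Sum>j\<in>B. X i j) = 1"
    and X_col: "\<And>j. j \<in> B \<Longrightarrow> (\<Sum>i\<in>A. X i j) = 1"
    and p_pos: "0 < p" and p_le: "p * exp 1 \<le> 1"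
begin

text \<open>Index \<open>(0, i, j)\<close> is the presence of the entry; \<open>(1, i, j)\<close> and \<open>(2, i, j)\<close> veto it as a row leaf
  and as a column leaf.  The vetoes make an entry \<open>x\<close> a leaf with probability \<open>1 - exp (- p * x)\<close>.\<close>

definition q :: "real \<Rightarrow> real" where
  "q x = (1 - exp (- p * x)) / ((1 - exp (- x)) * exp (- (1 - x)))"

definition idx :: "('a, 'b) idx set" where
  "idx = {0, 1, 2} \<times> A \<times> B"

text \<open>A veto occurs with probability \<open>1 - q\<close>, so \<open>q\<close> is the
  probability of being spared. Division by zero gives \<open>q 0 = 0\<close>, which agrees with an
  entry 0 never being present.\<close>

fun wt :: "('a, 'b) idx \<Rightarrow> real" where
  "wt (k, i, j) = (if k = 0 then 1 - exp (- X i j) else 1 - q (X i j))"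

definition row_rest :: "'a \<Rightarrow> 'b \<Rightarrow> ('a, 'b) idx set" where
  "row_rest i j = (\<lambda>j'. (0, i, j')) ` (B - {j})"

definition col_rest :: "'a \<Rightarrow> 'b \<Rightarrow> ('a, 'b) idx set" where
  "col_rest i j = (\<lambda>i'. (0, i', j)) ` (A - {i})"

text \<open>Written, like the two leaf predicates, as a required set and a forbidden set, so that
  the cylinder lemmas apply after unfolding. Isolation ignores the vetoes.\<close>

definition isolated :: "('a, 'b) idx set \<Rightarrow> 'a \<Rightarrow> 'b \<Rightarrow> bool" where
  "isolated S i j \<longleftrightarrow> {(0, i, j)} \<subseteq> S \<and> S \<inter> (row_rest i j \<union> col_rest i j) = {}"

definition row_leaf :: "('a, 'b) idx set \<Rightarrow> 'a \<Rightarrow> 'b \<Rightarrow> bool" where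
  "row_leaf S i j \<longleftrightarrow> {(0, i, j)} \<subseteq> S \<and> S \<inter> insert (1, i, j) (row_rest i j) = {}"

definition col_leaf :: "('a, 'b) idx set \<Rightarrow> 'a \<Rightarrow> 'b \<Rightarrow> bool" where
  "col_leaf S i j \<longleftrightarrow> {(0, i, j)} \<subseteq> S \<and> S \<inter> insert (2, i, j) (col_rest i j) = {}"

definition row_leaves :: "('a, 'b) idx set \<Rightarrow> 'b \<Rightarrow> 'a set" where
  "row_leaves S j = {i \<in> A. row_leaf S i j}"

definition col_leaves :: "('a, 'b) idx set \<Rightarrow> 'a \<Rightarrow> 'b set" where
  "col_leaves S i = {j \<in> B. col_leaf S i j}"

definition row_deg :: "('a, 'b) idx set \<Rightarrow> 'a \<Rightarrow> nat" where
  "row_deg S i = card {j \<in> B. (0, i, j) \<in> S}"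

definition col_deg :: "('a, 'b) idx set \<Rightarrow> 'b \<Rightarrow> nat" where
  "col_deg S j = card {i \<in> A. (0, i, j) \<in> S}"

definition col_pick :: "'b \<Rightarrow> 'a set \<Rightarrow> 'a \<Rightarrow> real" where
  "col_pick j = (SOME r. is_item_scheme A (\<lambda>i. p * X i j) r)"

definition row_pick :: "'a \<Rightarrow> 'b set \<Rightarrow> 'b \<Rightarrow> real" where
  "row_pick i = (SOME r. is_item_scheme B (\<lambda>j. p * X i j) r)"

text \<open>The factor 2 is affordable because the degrees of the opposite lines are at least 2.\<close>

definition late :: "('a, 'b) idx set \<Rightarrow> 'a \<Rightarrow> 'b \<Rightarrow> real" where
  "late S i j = (if (0, i, j) \<in> S \<and> row_leaves S j = {} \<and> col_leaves S i = {} \<and> 2 \<le> row_deg S i \<and> 2 \<le> col_deg S j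
     then 2 / (real (row_deg S i) * real (col_deg S j)) else 0)"

text \<open>An isolated entry may also be a leaf of one or both lines. It then receives 1 in place
  of its shares, which would otherwise be counted on top.\<close>

definition alloc :: "('a, 'b) idx set \<Rightarrow> 'a \<Rightarrow> 'b \<Rightarrow> real" where
  "alloc S i j = of_bool (isolated S i j) +
     of_bool (\<not> isolated S i j) * (col_pick j (row_leaves S j) i + row_pick i (col_leaves S i) j) + late S i j"

section \<open>Probabilities of vetoes, leaves and isolated entries\<close>

lemma fin_idx [simp]: "finite idx"
  using finA finB by (simp add: idx_def)

lemma X_le_1: "X i j \<le> 1" if "i \<in> A" "j \<in> B"
  using member_le_sum[of j B "X i"] X_row X_nonneg that finB by auto

lemma col_pick: "j \<in> B \<Longrightarrow> is_item_scheme A (\<lambda>i. p * X i j) (col_pick j)"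
  unfolding col_pick_def
  by (rule someI_ex[of "is_item_scheme A (\<lambda>i. p * X i j)"], rule item_scheme_exists)
    (use finA X_nonneg p_pos in auto)

lemma row_pick: "i \<in> A \<Longrightarrow> is_item_scheme B (\<lambda>j. p * X i j) (row_pick i)"
  unfolding row_pick_def
  by (rule someI_ex[of "is_item_scheme B (\<lambda>j. p * X i j)"], rule item_scheme_exists)
    (use finB X_nonneg p_pos in auto)

lemma leaf_prob:
  assumes "0 \<le> x"
  shows "(1 - exp (- x)) * (q x * exp (- (1 - x))) = 1 - exp (- p * x)"
proof (cases "x = 0")
  case False
  then show ?thesis by (simp add: q_def)
qed simp

text \<open>The chain 1 - exp (- p * x) \<le> p * x \<le> x / e \<le> (exp x - 1) / e ends at the
  probability that x is present and alone in its line.\<close>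

lemma q_bounds:
  assumes "0 \<le> x"
  shows "0 \<le> q x" "q x \<le> 1"
proof -
  show "0 \<le> q x" using assms p_pos by (simp add: q_def)
  have "1 - exp (- p * x) \<le> p * x" using exp_ge_add_one_self[of "- p * x"] by simp
  also have "\<dots> = p * exp 1 * (x * exp (- 1))" by (simp add: exp_minus)
  also have "\<dots> \<le> 1 * (x * exp (- 1))" using p_le assms by (intro mult_right_mono) auto
  also have "\<dots> \<le> 1 * ((exp x - 1) * exp (- 1))"
    unfolding mult_1_left using exp_ge_add_one_self[of x] by (intro mult_right_mono) (linarith, simp)
  also have "\<dots> = (1 - exp (- x)) * exp (- (1 - x))"
    by (simp add: algebra_simps exp_add[symmetric])
  finally have "1 - exp (- p * x) \<le> (1 - exp (- x)) * exp (- (1 - x))" .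
  then show "q x \<le> 1"
    using assms by (cases "x = 0") (auto simp: q_def divide_le_eq_1)
qed

lemma wt_bounds: "0 \<le> wt n \<and> wt n \<le> 1" if "n \<in> idx" for n
  using that X_nonneg q_bounds by (cases n) (auto simp: idx_def)

lemma prod_row_rest:
  assumes "i \<in> A" "j \<in> B"
  shows "(\<Prod>n\<in>row_rest i j. 1 - wt n) = exp (- (1 - X i j))"
proof -
  have "(\<Prod>n\<in>row_rest i j. 1 - wt n) = (\<Prod>j'\<in>B - {j}. exp (- X i j'))"
    unfolding row_rest_def by (subst prod.reindex) (auto simp: inj_on_def)
  also have "\<dots> = exp (- (\<Sum>j'\<in>B - {j}. X i j'))"
    using finB by (simp add: exp_sum[symmetric] sum_negf)
  also have "(\<Sum>j'\<in>B - {j}. X i j') = 1 - X i j"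
    using sum.remove[of B j "X i"] assms X_row finB by simp
  finally show ?thesis .
qed

lemma prod_col_rest:
  assumes "i \<in> A" "j \<in> B"
  shows "(\<Prod>n\<in>col_rest i j. 1 - wt n) = exp (- (1 - X i j))"
proof -
  have "(\<Prod>n\<in>col_rest i j. 1 - wt n) = (\<Prod>i'\<in>A - {i}. exp (- X i' j))"
    unfolding col_rest_def by (subst prod.reindex) (auto simp: inj_on_def)
  also have "\<dots> = exp (- (\<Sum>i'\<in>A - {i}. X i' j))"
    using finA by (simp add: exp_sum[symmetric] sum_negf)
  also have "(\<Sum>i'\<in>A - {i}. X i' j) = 1 - X i j"
    using sum.remove[of A i "\<lambda>i. X i j"] assms X_col finA by simp
  finally show ?thesis .
qed

lemma rest_facts:
  "finite (row_rest i j)" "finite (col_rest i j)" "row_rest i j \<inter> col_rest i j = {}"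
  "(k, i', j') \<in> row_rest i j \<longleftrightarrow> k = 0 \<and> i' = i \<and> j' \<in> B - {j}"
  "(k, i', j') \<in> col_rest i j \<longleftrightarrow> k = 0 \<and> j' = j \<and> i' \<in> A - {i}"
  using finA finB by (auto simp: row_rest_def col_rest_def)

lemma rest_subset: "i \<in> A \<Longrightarrow> j \<in> B \<Longrightarrow> row_rest i j \<subseteq> idx" "i \<in> A \<Longrightarrow> j \<in> B \<Longrightarrow> col_rest i j \<subseteq> idx"
  by (auto simp: row_rest_def col_rest_def idx_def)

lemma pick_rate_p: "p * pick_rate p = 1 - exp (- p)"
  using p_pos by (simp add: pick_rate_def)

text \<open>The leaves competing in one column have rates \<open>p * X i j\<close> with sum p,
  because the column sums to 1; hence the share per unit of \<open>X i j\<close> is the same in all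
  columns.\<close>

lemma expectation_col_pick:
  assumes "i \<in> A" "j \<in> B"
  shows "bexp idx wt (\<lambda>S. col_pick j (row_leaves S j) i) = X i j * (1 - exp (- p))"
proof -
  have "bexp idx wt (\<lambda>S. col_pick j (row_leaves S j) i) = p * X i j * pick_rate (\<Sum>i\<in>A. p * X i j)"
    unfolding row_leaves_def row_leaf_def
  proof (rule bexp_item_scheme_cylinders[OF finA fin_idx col_pick[OF assms(2)] _ _ _ assms(1)])
    fix i assume i: "i \<in> A"
    show "{(0, i, j)} \<subseteq> idx \<and> insert (1, i, j) (row_rest i j) \<subseteq> idx \<and> {(0, i, j)} \<inter> insert (1, i, j) (row_rest i j) = {}"
      using i assms rest_subset(1)[of i j] by (auto simp: idx_def rest_facts)
    have "(\<Prod>n\<in>insert (1, i, j) (row_rest i j). 1 - wt n) = q (X i j) * exp (- (1 - X i j))"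
      using prod_row_rest[OF i assms(2)] rest_facts by (subst prod.insert) auto
    then show "(\<Prod>n\<in>{(0, i, j)}. wt n) * (\<Prod>n\<in>insert (1, i, j) (row_rest i j). 1 - wt n) = 1 - exp (- (p * X i j))"
      using leaf_prob[OF X_nonneg[OF i assms(2)]] by simp
  qed (auto simp: disjoint_family_on_def rest_facts)
  also have "(\<Sum>i\<in>A. p * X i j) = p" using X_col assms by (simp add: sum_distrib_left[symmetric])
  finally show ?thesis using pick_rate_p by (simp add: mult_ac)
qed

lemma expectation_row_pick:
  assumes "i \<in> A" "j \<in> B"
  shows "bexp idx wt (\<lambda>S. row_pick i (col_leaves S i) j) = X i j * (1 - exp (- p))"
proof -
  have "bexp idx wt (\<lambda>S. row_pick i (col_leaves S i) j) = p * X i j * pick_rate (\<Sum>j\<in>B. p * X i j)"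
    unfolding col_leaves_def col_leaf_def
  proof (rule bexp_item_scheme_cylinders[OF finB fin_idx row_pick[OF assms(1)] _ _ _ assms(2)])
    fix j assume j: "j \<in> B"
    show "{(0, i, j)} \<subseteq> idx \<and> insert (2, i, j) (col_rest i j) \<subseteq> idx \<and> {(0, i, j)} \<inter> insert (2, i, j) (col_rest i j) = {}"
      using j assms rest_subset(2)[of i j] by (auto simp: idx_def rest_facts)
    have "(\<Prod>n\<in>insert (2, i, j) (col_rest i j). 1 - wt n) = q (X i j) * exp (- (1 - X i j))"
      using prod_col_rest[OF assms(1) j] rest_facts by (subst prod.insert) auto
    then show "(\<Prod>n\<in>{(0, i, j)}. wt n) * (\<Prod>n\<in>insert (2, i, j) (col_rest i j). 1 - wt n) = 1 - exp (- (p * X i j))"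
      using leaf_prob[OF X_nonneg[OF assms(1) j]] by simp
  qed (auto simp: disjoint_family_on_def rest_facts)
  also have "(\<Sum>j\<in>B. p * X i j) = p" using X_row assms by (simp add: sum_distrib_left[symmetric])
  finally show ?thesis using pick_rate_p by (simp add: mult_ac)
qed

lemma prob_isolated:
  assumes "i \<in> A" "j \<in> B"
  shows "bexp idx wt (\<lambda>S. of_bool (isolated S i j)) = (1 - exp (- X i j)) * (exp (- (1 - X i j)))\<^sup>2"
proof -
  have "(\<Prod>n\<in>row_rest i j \<union> col_rest i j. 1 - wt n) = (exp (- (1 - X i j)))\<^sup>2"
    using assms by (subst prod.union_disjoint)
      (simp_all add: rest_facts prod_row_rest prod_col_rest power2_eq_square)
  then show ?thesis
    unfolding isolated_def using assms rest_subset[OF assms]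
    by (subst bexp_cylinder[OF fin_idx]) (auto simp: idx_def rest_facts)
qed

text \<open>Besides being a leaf, the entry needs its other line to be empty, which costs the factor
  \<open>exp (- (1 - X i j))\<close>. The index k = 1 stands for the row leaf and k = 2 for the
  column leaf.\<close>

lemma prob_isolated_leaf:
  assumes "i \<in> A" "j \<in> B" "k = 1 \<or> k = 2"
  shows "bexp idx wt (\<lambda>S. of_bool ({(0, i, j)} \<subseteq> S \<and> S \<inter> insert (k, i, j) (row_rest i j \<union> col_rest i j) = {}))
    = (1 - exp (- p * X i j)) * exp (- (1 - X i j))"
proof -
  have "(\<Prod>n\<in>row_rest i j \<union> col_rest i j. 1 - wt n) = (exp (- (1 - X i j)))\<^sup>2"
    using assms by (subst prod.union_disjoint)
      (simp_all add: rest_facts prod_row_rest prod_col_rest power2_eq_square)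
  then have "(\<Prod>n\<in>insert (k, i, j) (row_rest i j \<union> col_rest i j). 1 - wt n) = q (X i j) * (exp (- (1 - X i j)))\<^sup>2"
    using assms(3) by (subst prod.insert) (auto simp: rest_facts)
  then have "bexp idx wt (\<lambda>S. of_bool ({(0, i, j)} \<subseteq> S \<and> S \<inter> insert (k, i, j) (row_rest i j \<union> col_rest i j) = {}))
    = (1 - exp (- X i j)) * (q (X i j) * (exp (- (1 - X i j)))\<^sup>2)"
    using assms rest_subset[OF assms(1,2)]
    by (subst bexp_cylinder[OF fin_idx]) (auto simp: idx_def rest_facts)
  also have "\<dots> = (1 - exp (- p * X i j)) * exp (- (1 - X i j))"
    using leaf_prob[OF X_nonneg[OF assms(1,2)]] by (simp only: power2_eq_square mult.assoc[symmetric])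
  finally show ?thesis .
qed

text \<open>\<open>S1\<close> and \<open>S2\<close> are the other present entries of row
  \<open>a\<close> and column \<open>b\<close>, and \<open>T\<close> collects the coordinates off
  both lines together with the vetoes. If both sets are nonempty, the degrees are at least 2 and the
  entry itself is no leaf; the hit conditions say that no entry of \<open>S1\<close> is a column
  leaf and none of \<open>S2\<close> is a row leaf.\<close>

lemma late_lower:
  assumes ab: "a \<in> A" "b \<in> B" and S: "S1 \<subseteq> row_rest a b" "S2 \<subseteq> col_rest a b" "T \<subseteq> idx - insert (0, a, b) (row_rest a b \<union> col_rest a b)"
  shows "9 / 8 * (of_bool (S1 \<noteq> {}) * (2 / 3) ^ card S1) * (of_bool (S2 \<noteq> {}) * (2 / 3) ^ card S2) *
      (of_bool (\<forall>n\<in>S1. T \<inter> (case n of (k, i, j) \<Rightarrow> insert (2, i, j) (col_rest i j)) \<noteq> {}) *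
       of_bool (\<forall>n\<in>S2. T \<inter> (case n of (k, i, j) \<Rightarrow> insert (1, i, j) (row_rest i j)) \<noteq> {}))
    \<le> late (insert (0, a, b) (S1 \<union> (S2 \<union> T))) a b"
proof -
  define S where "S = insert (0, a, b) (S1 \<union> (S2 \<union> T))"
  let ?u = "\<forall>n\<in>S1. T \<inter> (case n of (k, i, j) \<Rightarrow> insert (2, i, j) (col_rest i j)) \<noteq> {}"
  let ?v = "\<forall>n\<in>S2. T \<inter> (case n of (k, i, j) \<Rightarrow> insert (1, i, j) (row_rest i j)) \<noteq> {}"
  show ?thesis
  proof (cases "S1 \<noteq> {} \<and> S2 \<noteq> {} \<and> ?u \<and> ?v")
    case False
    then have "9 / 8 * (of_bool (S1 \<noteq> {}) * (2 / 3) ^ card S1) * (of_bool (S2 \<noteq> {}) * (2 / 3) ^ card S2) *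
      (of_bool ?u * of_bool ?v) = (0::real)" by auto
    then show ?thesis by (simp only:) (simp add: late_def)
  next
    case True
    have hit: ?u ?v and ne: "S1 \<noteq> {}" "S2 \<noteq> {}" using True by blast+
    define J where "J = {j \<in> B - {b}. (0, a, j) \<in> S1}"
    define I where "I = {i \<in> A - {a}. (0, i, b) \<in> S2}"
    have fin: "finite J" "finite I" using finA finB by (auto simp: J_def I_def)
    have S1: "S1 = (\<lambda>j. (0, a, j)) ` J" and S2: "S2 = (\<lambda>i. (0, i, b)) ` I"
      using S by (auto simp: J_def I_def row_rest_def col_rest_def)
    have card: "card S1 = card J" "card S2 = card I"
      unfolding S1 S2 by (auto intro!: card_image simp: inj_on_def)
    have rd: "{j \<in> B. (0, a, j) \<in> S} = insert b J" and cd: "{i \<in> A. (0, i, b) \<in> S} = insert a I"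
      using ab S by (auto simp: S_def J_def I_def rest_facts)
    have "row_deg S a = Suc (card J)" "col_deg S b = Suc (card I)"
      unfolding row_deg_def col_deg_def rd cd using fin by (auto simp: J_def I_def)
    moreover have pos: "1 \<le> card J" "1 \<le> card I"
      using ne fin S1 S2 by (auto simp: Suc_le_eq card_gt_0_iff)
    moreover have "row_leaves S b = {}"
    proof -
      have "\<not> row_leaf S i b" if "i \<in> A" for i
      proof (cases "i = a")
        case True
        then show ?thesis using ne S by (auto simp: row_leaf_def S_def)
      next
        case False
        show ?thesis
        proof
          assume *: "row_leaf S i b"
          then have "(0, i, b) \<in> S2"
            using False that S by (auto simp: row_leaf_def S_def rest_facts)
          then have "T \<inter> insert (1, i, b) (row_rest i b) \<noteq> {}"
            using hit(2) by (auto dest: bspec)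
          then show False using * by (auto simp: row_leaf_def S_def)
        qed
      qed
      then show ?thesis by (auto simp: row_leaves_def)
    qed
    moreover have "col_leaves S a = {}"
    proof -
      have "\<not> col_leaf S a j" if "j \<in> B" for j
      proof (cases "j = b")
        case True
        then show ?thesis using ne S by (auto simp: col_leaf_def S_def)
      next
        case False
        show ?thesis
        proof
          assume *: "col_leaf S a j"
          then have "(0, a, j) \<in> S1"
            using False that S by (auto simp: col_leaf_def S_def rest_facts)
          then have "T \<inter> insert (2, a, j) (col_rest a j) \<noteq> {}"
            using hit(1) by (auto dest: bspec)
          then show False using * by (auto simp: col_leaf_def S_def)
        qed
      qed
      then show ?thesis by (auto simp: col_leaves_def)
    qed
    moreover have "(0, a, b) \<in> S" by (simp add: S_def)
    ultimately have "late S a b = 2 * ((1 / real (Suc (card J))) * (1 / real (Suc (card I))))"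
      by (simp add: late_def)
    \<comment> \<open>The factor 9 / 8 is 2 * (3 / 4) * (3 / 4).\<close>
    also have "\<dots> \<ge> 2 * ((3 / 4 * (2 / 3) ^ card J) * (3 / 4 * (2 / 3) ^ card I))"
      by (intro mult_left_mono mult_mono geometric_le_inverse_Suc pos) auto
    finally have "9 / 8 * (2 / 3) ^ card S1 * (2 / 3) ^ card S2 \<le> late S a b" using card by (simp add: mult_ac)
    moreover have "of_bool (S1 \<noteq> {}) = (1::real)" "of_bool (S2 \<noteq> {}) = (1::real)" "of_bool ?u = (1::real)" "of_bool ?v = (1::real)"
      using True by simp_all
    ultimately show ?thesis unfolding S_def by (simp only: mult_1_left mult_1_right)
  qed
qed

text \<open>For fixed \<open>S1\<close> and \<open>S2\<close> the two hit conditions share the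
  entries off both lines, so they are dependent. Both are increasing in \<open>T\<close>, and
  Harris' inequality separates row and column; each factor then sees a line of remaining mass 1 -
  x.\<close>

lemma expectation_late:
  assumes ab: "a \<in> A" "b \<in> B"
  defines "x \<equiv> X a b"
  shows "9 / 8 * (1 - exp (- x)) * (exp (- (1 + 2 * p) / 3 * (1 - x)) - exp (- (1 - x)))\<^sup>2
    \<le> bexp idx wt (\<lambda>S. late S a b)"
proof -
  define R where "R = row_rest a b"
  define C where "C = col_rest a b"
  define Q where "Q = idx - insert (0, a, b) (R \<union> C)"
  define M where "M n = (case n of (k, i, j) \<Rightarrow> insert (2, i, j) (col_rest i j))" for n :: "('a, 'b) idx"
  define N where "N n = (case n of (k, i, j) \<Rightarrow> insert (1, i, j) (row_rest i j))" for n :: "('a, 'b) idx"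
  define h where "h S = of_bool (S \<noteq> {}) * (2 / 3 :: real) ^ card S" for S :: "('a, 'b) idx set"
  define u where "u S T = (of_bool (\<forall>n\<in>S. T \<inter> M n \<noteq> {}) :: real)" for S T :: "('a, 'b) idx set"
  define v where "v S T = (of_bool (\<forall>n\<in>S. T \<inter> N n \<noteq> {}) :: real)" for S T :: "('a, 'b) idx set"
  \<comment> \<open>The probability that a present entry of the row is no column leaf: its presence
    lies in \<open>R\<close>, the coordinates that decide the rest in \<open>Q\<close>.\<close>
  define mu where "mu n = 1 - (\<Prod>l\<in>M n. 1 - wt l)" for n
  define nu where "nu n = 1 - (\<Prod>l\<in>N n. 1 - wt l)" for n
  have fin: "finite R" "finite C" "finite Q" by (simp_all add: R_def C_def Q_def rest_facts)
  have sub: "R \<subseteq> idx" "C \<subseteq> idx" "Q \<subseteq> idx" using rest_subset[OF ab] by (auto simp: R_def C_def Q_def)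
  have disj: "R \<inter> (C \<union> Q) = {}" "C \<inter> Q = {}" by (auto simp: R_def C_def Q_def rest_facts)
  have ab0: "(0, a, b) \<in> idx" "(0, a, b) \<notin> R \<union> (C \<union> Q)"
    using ab by (auto simp: idx_def R_def C_def Q_def rest_facts)
  have idx: "idx = insert (0, a, b) (R \<union> (C \<union> Q))" using ab0 sub by (auto simp: Q_def)
  have late0: "0 \<le> late S i j" for S i j by (simp add: late_def)
  have wtb: "0 \<le> wt n \<and> wt n \<le> 1" if "n \<in> R \<or> n \<in> C \<or> n \<in> Q" for n using wt_bounds sub that by blast
  \<comment> \<open>Different entries of row \<open>a\<close> lie in different columns, so their
    sets \<open>M n\<close> are disjoint and the hits are independent.\<close>
  have U: "bexp Q wt (u S) = (\<Prod>n\<in>S. mu n)" if S: "S \<subseteq> R" for S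
    unfolding u_def mu_def
  proof (rule bexp_hit_all[OF fin(3) finite_subset[OF S fin(1)]])
    have *: "\<exists>j. n = (0, a, j) \<and> j \<in> B - {b}" if "n \<in> S" for n
      using that S by (auto simp: R_def row_rest_def)
    show "M n \<subseteq> Q" if n: "n \<in> S" for n
      using *[OF n] ab by (auto simp: M_def Q_def R_def C_def idx_def rest_facts)
    show "disjoint_family_on M S"
      unfolding disjoint_family_on_def
    proof (intro ballI impI)
      fix m n assume "m \<in> S" "n \<in> S" "m \<noteq> n"
      then show "M m \<inter> M n = {}" using *[of m] *[of n] by (auto simp: M_def rest_facts)
    qed
  qed
  have V: "bexp Q wt (v S) = (\<Prod>n\<in>S. nu n)" if S: "S \<subseteq> C" for S
    unfolding v_def nu_def
  proof (rule bexp_hit_all[OF fin(3) finite_subset[OF S fin(2)]])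
    have *: "\<exists>i. n = (0, i, b) \<and> i \<in> A - {a}" if "n \<in> S" for n
      using that S by (auto simp: C_def col_rest_def)
    show "N n \<subseteq> Q" if n: "n \<in> S" for n
      using *[OF n] ab by (auto simp: N_def Q_def R_def C_def idx_def rest_facts)
    show "disjoint_family_on N S"
      unfolding disjoint_family_on_def
    proof (intro ballI impI)
      fix m n assume "m \<in> S" "n \<in> S" "m \<noteq> n"
      then show "N m \<inter> N n = {}" using *[of m] *[of n] by (auto simp: N_def rest_facts)
    qed
  qed
  define xx where "xx n = (case n of (k, i, j) \<Rightarrow> X i j)" for n :: "('a, 'b) idx"
  have sumR: "(\<Sum>n\<in>R. xx n) = 1 - x"
    using sum.remove[of B b "X a"] ab X_row finB
    by (simp add: R_def row_rest_def xx_def sum.reindex inj_on_def x_def)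
  have sumC: "(\<Sum>n\<in>C. xx n) = 1 - x"
    using sum.remove[of A a "\<lambda>i. X i b"] ab X_col finA
    by (simp add: C_def col_rest_def xx_def sum.reindex inj_on_def x_def)
  let ?D = "exp (- (1 + 2 * p) / 3 * (1 - x)) - exp (- (1 - x))"
  have DR: "?D \<le> bexp R wt (\<lambda>S. h S * (\<Prod>n\<in>S. mu n))"
    unfolding h_def sumR[symmetric]
  proof (rule bexp_nonempty_geometric[OF fin(1)])
    fix n assume "n \<in> R"
    then obtain j where n: "n = (0, a, j)" "j \<in> B" by (auto simp: R_def row_rest_def)
    show w: "wt n = 1 - exp (- xx n)" by (simp add: n xx_def)
    have "(\<Prod>l\<in>M n. 1 - wt l) = q (X a j) * exp (- (1 - X a j))"
      using prod_col_rest[OF ab(1) n(2)] by (simp add: M_def n rest_facts)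
    then have "wt n * mu n = wt n - (1 - exp (- X a j)) * (q (X a j) * exp (- (1 - X a j)))"
      by (simp add: mu_def w n xx_def algebra_simps)
    then show "wt n * mu n = exp (- p * xx n) - exp (- xx n)"
      unfolding leaf_prob[OF X_nonneg[OF ab(1) n(2)]] by (simp add: w n xx_def)
  qed
  have DC: "?D \<le> bexp C wt (\<lambda>S. h S * (\<Prod>n\<in>S. nu n))"
    unfolding h_def sumC[symmetric]
  proof (rule bexp_nonempty_geometric[OF fin(2)])
    fix n assume "n \<in> C"
    then obtain i where n: "n = (0, i, b)" "i \<in> A" by (auto simp: C_def col_rest_def)
    show w: "wt n = 1 - exp (- xx n)" by (simp add: n xx_def)
    have "(\<Prod>l\<in>N n. 1 - wt l) = q (X i b) * exp (- (1 - X i b))"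
      using prod_row_rest[OF n(2) ab(2)] by (simp add: N_def n rest_facts)
    then have "wt n * nu n = wt n - (1 - exp (- X i b)) * (q (X i b) * exp (- (1 - X i b)))"
      by (simp add: nu_def w n xx_def algebra_simps)
    then show "wt n * nu n = exp (- p * xx n) - exp (- xx n)"
      unfolding leaf_prob[OF X_nonneg[OF n(2) ab(2)]] by (simp add: w n xx_def)
  qed
  \<comment> \<open>Multiplying the bounds for row and column requires \<open>?D\<close> to be
    nonnegative, which holds since p is at most 1.\<close>
  have "p * 1 \<le> p * exp 1" using p_pos by (intro mult_left_mono) auto
  then have "p \<le> 1" using p_le by simp
  moreover have x1: "x \<le> 1" "0 \<le> x" using X_le_1[OF ab] X_nonneg[OF ab] by (auto simp: x_def)
  ultimately have "(1 + 2 * p) / 3 * (1 - x) \<le> 1 * (1 - x)" by (intro mult_right_mono) auto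
  then have "- (1 - x) \<le> - (1 + 2 * p) / 3 * (1 - x)" by (simp add: field_simps)
  then have D0: "0 \<le> ?D" by simp
  have h0: "0 \<le> h S" for S by (simp add: h_def)
  have harris: "(\<Prod>n\<in>S1. mu n) * (\<Prod>n\<in>S2. nu n) \<le> bexp Q wt (\<lambda>T. u S1 T * v S2 T)"
    if "S1 \<subseteq> R" "S2 \<subseteq> C" for S1 S2
  proof -
    have "bexp Q wt (u S1) * bexp Q wt (v S2) \<le> bexp Q wt (\<lambda>T. u S1 T * v S2 T)"
    proof (rule harris_inequality[OF fin(3), of wt "u S1" "v S2"])
    fix S T :: "('a, 'b) idx set" assume "S \<subseteq> T"
    then have "\<And>K. S \<inter> K \<noteq> {} \<Longrightarrow> T \<inter> K \<noteq> {}" by blast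
    then show "u S1 S \<le> u S1 T" "v S2 S \<le> v S2 T" by (simp_all add: u_def v_def of_bool_def)
    qed (use wtb in auto)
    then show ?thesis by (simp only: U[OF that(1)] V[OF that(2)])
  qed
  have "9 / 8 * ?D\<^sup>2 \<le> 9 / 8 * (bexp R wt (\<lambda>S. h S * (\<Prod>n\<in>S. mu n)) * bexp C wt (\<lambda>S. h S * (\<Prod>n\<in>S. nu n)))"
    unfolding power2_eq_square
    using order_trans[OF D0 DR] by (intro mult_left_mono mult_mono DR DC D0) simp_all
  also have "\<dots> = bexp R wt (\<lambda>S1. bexp C wt (\<lambda>S2. 9 / 8 * h S1 * h S2 * ((\<Prod>n\<in>S1. mu n) * (\<Prod>n\<in>S2. nu n))))"
  proof -
    have "9 / 8 * h S1 * h S2 * ((\<Prod>n\<in>S1. mu n) * (\<Prod>n\<in>S2. nu n))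
        = (9 / 8 * (h S1 * (\<Prod>n\<in>S1. mu n))) * (h S2 * (\<Prod>n\<in>S2. nu n))" for S1 S2
      by simp
    then have "bexp R wt (\<lambda>S1. bexp C wt (\<lambda>S2. 9 / 8 * h S1 * h S2 * ((\<Prod>n\<in>S1. mu n) * (\<Prod>n\<in>S2. nu n))))
      = bexp R wt (\<lambda>S1. bexp C wt (\<lambda>S2. (9 / 8 * (h S1 * (\<Prod>n\<in>S1. mu n))) * (h S2 * (\<Prod>n\<in>S2. nu n))))"
      by presburger
    then show ?thesis by (simp only: bexp_cmult bexp_multc mult.assoc[of _ "bexp _ _ _"])
  qed
  also have "\<dots> \<le> bexp R wt (\<lambda>S1. bexp C wt (\<lambda>S2. bexp Q wt (\<lambda>T. late (insert (0, a, b) (S1 \<union> (S2 \<union> T))) a b)))"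
  proof (intro bexp_mono)
    fix S1 S2 assume S: "S1 \<subseteq> R" "S2 \<subseteq> C"
    have "9 / 8 * h S1 * h S2 * ((\<Prod>n\<in>S1. mu n) * (\<Prod>n\<in>S2. nu n))
        \<le> 9 / 8 * h S1 * h S2 * bexp Q wt (\<lambda>T. u S1 T * v S2 T)"
      using harris[OF S] h0 by (intro mult_left_mono) auto
    also have "\<dots> = bexp Q wt (\<lambda>T. 9 / 8 * h S1 * h S2 * (u S1 T * v S2 T))" by (simp only: bexp_cmult)
    also have "\<dots> \<le> bexp Q wt (\<lambda>T. late (insert (0, a, b) (S1 \<union> (S2 \<union> T))) a b)"
    proof (intro bexp_mono)
      fix T assume T: "T \<subseteq> Q"
      show "9 / 8 * h S1 * h S2 * (u S1 T * v S2 T) \<le> late (insert (0, a, b) (S1 \<union> (S2 \<union> T))) a b"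
        using late_lower[OF ab S[unfolded R_def C_def] T[unfolded Q_def R_def C_def]]
        by (simp only: h_def u_def v_def M_def N_def)
    qed (use wtb in auto)
    finally show "9 / 8 * h S1 * h S2 * ((\<Prod>n\<in>S1. mu n) * (\<Prod>n\<in>S2. nu n))
      \<le> bexp Q wt (\<lambda>T. late (insert (0, a, b) (S1 \<union> (S2 \<union> T))) a b)" .
  qed (use wtb in auto)
  also have "\<dots> = bexp (R \<union> (C \<union> Q)) wt (\<lambda>S. late (insert (0, a, b) S) a b)"
    using fin disj by (simp only: bexp_Un finite_Un simp_thms)
  finally have main: "9 / 8 * ?D\<^sup>2 \<le> bexp (R \<union> (C \<union> Q)) wt (\<lambda>S. late (insert (0, a, b) S) a b)" .
  have "bexp idx wt (\<lambda>S. late S a b) = wt (0, a, b) * bexp (R \<union> (C \<union> Q)) wt (\<lambda>S. late (insert (0, a, b) S) a b)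
     + (1 - wt (0, a, b)) * bexp (R \<union> (C \<union> Q)) wt (\<lambda>S. late S a b)"
    unfolding idx using fin ab0(2) by (intro bexp_insert) auto
  also have "\<dots> \<ge> wt (0, a, b) * (9 / 8 * ?D\<^sup>2) + 0"
    using main wt_bounds[OF ab0(1)] wtb late0
    by (intro add_mono mult_left_mono mult_nonneg_nonneg bexp_nonneg) auto
  finally have "wt (0, a, b) * (9 / 8 * ?D\<^sup>2) \<le> bexp idx wt (\<lambda>S. late S a b)" by simp
  moreover have "wt (0, a, b) = 1 - exp (- x)" by (simp add: x_def)
  ultimately show ?thesis by (simp only: mult_ac)
qed

section \<open>Row and column sums of the allocation\<close>

lemma pick_facts:
  assumes "i \<in> A" "j \<in> B"
  shows "0 \<le> col_pick j (row_leaves S j) i" "0 \<le> row_pick i (col_leaves S i) j"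
    and "\<not> row_leaf S i j \<Longrightarrow> col_pick j (row_leaves S j) i = 0"
    and "\<not> col_leaf S i j \<Longrightarrow> row_pick i (col_leaves S i) j = 0"
    and "col_pick j (row_leaves S j) i \<le> 1" "row_pick i (col_leaves S i) j \<le> 1"
    and "(\<Sum>i\<in>A. col_pick j (row_leaves S j) i) \<le> 1" "(\<Sum>j\<in>B. row_pick i (col_leaves S i) j) \<le> 1"
proof -
  have sub: "row_leaves S j \<subseteq> A" "col_leaves S i \<subseteq> B" by (auto simp: row_leaves_def col_leaves_def)
  have c: "0 \<le> col_pick j (row_leaves S j) i'" "i' \<notin> row_leaves S j \<Longrightarrow> col_pick j (row_leaves S j) i' = 0" for i'
    using col_pick[OF assms(2)] sub unfolding is_item_scheme_def by blast+
  have r: "0 \<le> row_pick i (col_leaves S i) j'" "j' \<notin> col_leaves S i \<Longrightarrow> row_pick i (col_leaves S i) j' = 0" for j'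
    using row_pick[OF assms(1)] sub unfolding is_item_scheme_def by blast+
  show "0 \<le> col_pick j (row_leaves S j) i" "0 \<le> row_pick i (col_leaves S i) j" by (rule c r)+
  show "col_pick j (row_leaves S j) i = 0" if "\<not> row_leaf S i j"
    using that by (intro c(2)) (simp add: row_leaves_def)
  show "row_pick i (col_leaves S i) j = 0" if "\<not> col_leaf S i j"
    using that by (intro r(2)) (simp add: col_leaves_def)
  show C: "(\<Sum>i\<in>A. col_pick j (row_leaves S j) i) \<le> 1"
  proof (cases "row_leaves S j = {}")
    case True
    then have "(\<Sum>i\<in>A. col_pick j (row_leaves S j) i) = 0" using c(2) by (intro sum.neutral) auto
    then show ?thesis by simp
  next
    case False
    then show ?thesis using col_pick[OF assms(2)] sub unfolding is_item_scheme_def by simp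
  qed
  show R: "(\<Sum>j\<in>B. row_pick i (col_leaves S i) j) \<le> 1"
  proof (cases "col_leaves S i = {}")
    case True
    then have "(\<Sum>j\<in>B. row_pick i (col_leaves S i) j) = 0" using r(2) by (intro sum.neutral) auto
    then show ?thesis by simp
  next
    case False
    then show ?thesis using row_pick[OF assms(1)] sub unfolding is_item_scheme_def by simp
  qed
  show "col_pick j (row_leaves S j) i \<le> 1"
    using order_trans[OF member_le_sum[of i A "col_pick j (row_leaves S j)"] C] assms c finA by blast
  show "row_pick i (col_leaves S i) j \<le> 1"
    using order_trans[OF member_le_sum[of j B "row_pick i (col_leaves S i)"] R] assms r finB by blast
qed

lemma late_nonneg: "0 \<le> late S i j"
  by (simp add: late_def)

lemma alloc_nonneg: "i \<in> A \<Longrightarrow> j \<in> B \<Longrightarrow> 0 \<le> alloc S i j"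
  unfolding alloc_def using pick_facts(1,2) late_nonneg by (intro add_nonneg_nonneg mult_nonneg_nonneg) auto

lemma alloc_absent:
  assumes "i \<in> A" "j \<in> B" "(0, i, j) \<notin> S"
  shows "alloc S i j = 0"
  using assms pick_facts(3,4)[OF assms(1,2), of S]
  by (simp add: alloc_def isolated_def row_leaf_def col_leaf_def late_def)

lemma sum_late_col:
  assumes "j \<in> B"
  shows "(\<Sum>i\<in>A. late S i j) \<le> 1"
proof (cases "2 \<le> col_deg S j")
  case True
  have "(\<Sum>i\<in>A. late S i j) \<le> (\<Sum>i\<in>A. if (0, i, j) \<in> S then 1 / real (col_deg S j) else 0)"
    using True by (intro sum_mono) (auto simp: late_def divide_simps)
  also have "\<dots> = real (col_deg S j) * (1 / real (col_deg S j))"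
    using finA by (simp add: sum.If_cases col_deg_def Int_def)
  also have "\<dots> = 1" using True by simp
  finally show ?thesis .
qed (simp add: late_def)

lemma sum_late_row:
  assumes "i \<in> A"
  shows "(\<Sum>j\<in>B. late S i j) \<le> 1"
proof (cases "2 \<le> row_deg S i")
  case True
  have "(\<Sum>j\<in>B. late S i j) \<le> (\<Sum>j\<in>B. if (0, i, j) \<in> S then 1 / real (row_deg S i) else 0)"
    using True by (intro sum_mono) (auto simp: late_def divide_simps)
  also have "\<dots> = real (row_deg S i) * (1 / real (row_deg S i))"
    using finB by (simp add: sum.If_cases row_deg_def Int_def)
  also have "\<dots> = 1" using True by simp
  finally show ?thesis .
qed (simp add: late_def)

lemma single_col:
  assumes "i \<in> A" "(0, i, j) \<in> S" "S \<inter> col_rest i j = {}"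
  shows "\<And>i'. i' \<in> A \<Longrightarrow> i' \<noteq> i \<Longrightarrow> (0, i', j) \<notin> S" "late S i j = 0"
proof -
  show *: "(0, i', j) \<notin> S" if "i' \<in> A" "i' \<noteq> i" for i'
    using that assms(3) by (auto simp: col_rest_def)
  have "{i' \<in> A. (0, i', j) \<in> S} = {i}" using * assms(1,2) by blast
  then show "late S i j = 0" by (simp add: late_def col_deg_def)
qed

lemma single_row:
  assumes "j \<in> B" "(0, i, j) \<in> S" "S \<inter> row_rest i j = {}"
  shows "\<And>j'. j' \<in> B \<Longrightarrow> j' \<noteq> j \<Longrightarrow> (0, i, j') \<notin> S" "late S i j = 0"
proof -
  show *: "(0, i, j') \<notin> S" if "j' \<in> B" "j' \<noteq> j" for j'
    using that assms(3) by (auto simp: row_rest_def)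
  have "{j' \<in> B. (0, i, j') \<in> S} = {j}" using * assms(1,2) by blast
  then show "late S i j = 0" by (simp add: late_def row_deg_def)
qed

text \<open>An entry that is a leaf of both lines is isolated. So a leaf that is not isolated
  receives at most one share, and no late weight since one of its degrees is 1.\<close>

lemma alloc_single:
  assumes "i \<in> A" "j \<in> B" "isolated S i j \<or> row_leaf S i j \<or> col_leaf S i j"
  shows "alloc S i j \<le> 1"
proof (cases "isolated S i j")
  case True
  then show ?thesis using single_col(2)[of i j S] assms by (simp add: alloc_def isolated_def Int_Un_distrib)
next
  case False
  then have "\<not> (row_leaf S i j \<and> col_leaf S i j)" by (auto simp: isolated_def row_leaf_def col_leaf_def)
  moreover have "late S i j = 0"
    using assms(3) False single_row(2)[of j i S] single_col(2)[of i j S] assms(1,2)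
    by (auto simp: row_leaf_def col_leaf_def)
  ultimately show ?thesis
    using assms False pick_facts(3-6)[OF assms(1,2), of S] by (auto simp: alloc_def)
qed

text \<open>An isolated entry or column leaf is the only present entry of its column. Otherwise the
  column carries only the shares of its row leaves or, if there are none, late weight.\<close>

lemma alloc_col_sum:
  assumes j: "j \<in> B"
  shows "(\<Sum>i\<in>A. alloc S i j) \<le> 1"
proof (cases "\<exists>i\<in>A. isolated S i j \<or> col_leaf S i j")
  case True
  then obtain i where i: "i \<in> A" "isolated S i j \<or> col_leaf S i j" by blast
  then have "(0, i, j) \<in> S" "S \<inter> col_rest i j = {}" by (auto simp: isolated_def col_leaf_def)
  then have "alloc S i' j = 0" if "i' \<in> A - {i}" for i'
    using single_col(1)[of i j S] i that j by (intro alloc_absent) auto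
  then have "(\<Sum>i\<in>A. alloc S i j) = alloc S i j"
    using finA i(1) by (subst sum.remove[of _ i]) auto
  also have "\<dots> \<le> 1" using alloc_single[of i j S] i j by auto
  finally show ?thesis .
next
  case False
  then have "(\<Sum>i\<in>A. alloc S i j) = (\<Sum>i\<in>A. col_pick j (row_leaves S j) i + late S i j)"
    using pick_facts(4) j by (intro sum.cong) (auto simp: alloc_def)
  also have "\<dots> \<le> 1"
  proof (cases "row_leaves S j = {}")
    case True
    then have "(\<Sum>i\<in>A. col_pick j (row_leaves S j) i + late S i j) = (\<Sum>i\<in>A. late S i j)"
      using pick_facts(3) j by (intro sum.cong) (auto simp: row_leaves_def)
    then show ?thesis using sum_late_col[OF j] by simp
  next
    case False
    then have "\<And>i. late S i j = 0" by (simp add: late_def)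
    moreover from False obtain i where "i \<in> A" by (auto simp: row_leaves_def)
    ultimately show ?thesis using pick_facts(7)[of i j] j by simp
  qed
  finally show ?thesis .
qed

lemma alloc_row_sum:
  assumes i: "i \<in> A"
  shows "(\<Sum>j\<in>B. alloc S i j) \<le> 1"
proof (cases "\<exists>j\<in>B. isolated S i j \<or> row_leaf S i j")
  case True
  then obtain j where j: "j \<in> B" "isolated S i j \<or> row_leaf S i j" by blast
  then have "(0, i, j) \<in> S" "S \<inter> row_rest i j = {}" by (auto simp: isolated_def row_leaf_def)
  then have "alloc S i j' = 0" if "j' \<in> B - {j}" for j'
    using single_row(1)[of j i S] j that i by (intro alloc_absent) auto
  then have "(\<Sum>j\<in>B. alloc S i j) = alloc S i j"
    using finB j(1) by (subst sum.remove[of _ j]) auto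
  also have "\<dots> \<le> 1" using alloc_single[of i j S] i j by auto
  finally show ?thesis .
next
  case False
  then have "(\<Sum>j\<in>B. alloc S i j) = (\<Sum>j\<in>B. row_pick i (col_leaves S i) j + late S i j)"
    using pick_facts(3) i by (intro sum.cong) (auto simp: alloc_def)
  also have "\<dots> \<le> 1"
  proof (cases "col_leaves S i = {}")
    case True
    then have "(\<Sum>j\<in>B. row_pick i (col_leaves S i) j + late S i j) = (\<Sum>j\<in>B. late S i j)"
      using pick_facts(4) i by (intro sum.cong) (auto simp: col_leaves_def)
    then show ?thesis using sum_late_row[OF i] by simp
  next
    case False
    then have "\<And>j. late S i j = 0" by (simp add: late_def)
    moreover from False obtain j where "j \<in> B" by (auto simp: col_leaves_def)
    ultimately show ?thesis using pick_facts(8)[of i j] i by simp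
  qed
  finally show ?thesis .
qed

lemma substochastic_alloc: "substochastic A B (alloc S)"
  using alloc_nonneg alloc_row_sum alloc_col_sum by (auto simp: substochastic_def)

text \<open>Counting isolation and both shares in full overcounts only on isolated entries. There a
  share is at most 1 and vanishes unless the entry is the corresponding leaf, so the excess is at
  most the isolated-leaf indicator \<open>il\<close>.\<close>

lemma expectation_alloc:
  assumes ab: "a \<in> A" "b \<in> B"
  defines "x \<equiv> X a b"
  shows "2 * x * (1 - exp (- p)) - 2 * (1 - exp (- p * x)) * exp (- (1 - x)) + (1 - exp (- x)) * (exp (- (1 - x)))\<^sup>2
      + 9 / 8 * (1 - exp (- x)) * (exp (- (1 + 2 * p) / 3 * (1 - x)) - exp (- (1 - x)))\<^sup>2
    \<le> bexp idx wt (\<lambda>S. alloc S a b)"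
proof -
  define il where "il k S = (of_bool ({(0, a, b)} \<subseteq> S \<and> S \<inter> insert (k, a, b) (row_rest a b \<union> col_rest a b) = {}) :: real)"
    for k and S :: "('a, 'b) idx set"
  have pw: "of_bool (isolated S a b) + (col_pick b (row_leaves S b) a - il 1 S)
      + (row_pick a (col_leaves S a) b - il 2 S) + late S a b \<le> alloc S a b" for S
  proof (cases "isolated S a b")
    case False
    then have "il 1 S = 0" "il 2 S = 0" by (auto simp: il_def isolated_def)
    then show ?thesis using False by (simp add: alloc_def)
  next
    case True
    have "row_leaf S a b \<Longrightarrow> il 1 S = 1" "col_leaf S a b \<Longrightarrow> il 2 S = 1" "0 \<le> il 1 S" "0 \<le> il 2 S"
      using True by (auto simp: il_def isolated_def row_leaf_def col_leaf_def)
    then have "col_pick b (row_leaves S b) a \<le> il 1 S" "row_pick a (col_leaves S a) b \<le> il 2 S"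
      using pick_facts(3-6)[OF ab, of S] by (cases "row_leaf S a b"; cases "col_leaf S a b"; simp)+
    then show ?thesis using True by (simp add: alloc_def)
  qed
  have "bexp idx wt (\<lambda>S. of_bool (isolated S a b) + (col_pick b (row_leaves S b) a - il 1 S)
      + (row_pick a (col_leaves S a) b - il 2 S) + late S a b) \<le> bexp idx wt (\<lambda>S. alloc S a b)"
    by (intro bexp_mono pw wt_bounds)
  moreover have "bexp idx wt (il 1) = (1 - exp (- p * x)) * exp (- (1 - x))"
    "bexp idx wt (il 2) = (1 - exp (- p * x)) * exp (- (1 - x))"
    unfolding il_def x_def by (rule prob_isolated_leaf[OF ab], simp)+
  ultimately show ?thesis
    using expectation_late[OF ab, folded x_def]
    unfolding bexp_add bexp_diff prob_isolated[OF ab] expectation_col_pick[OF ab] expectation_row_pick[OF ab] x_def[symmetric]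
    by (simp only: mult.assoc)
qed

end

subsection \<open>The balance of the allocation\<close>

lemma exp_taylor_even:
  fixes x :: real
  assumes "even n"
  shows "(\<Sum>m<n. x ^ m / fact m) \<le> exp x"
proof -
  obtain t where "exp x = (\<Sum>m<n. x ^ m / fact m) + exp t / fact n * x ^ n"
    using Maclaurin_exp_le[of x n] by blast
  moreover have "0 \<le> exp t / fact n * x ^ n" using assms by (simp add: zero_le_even_power)
  ultimately show ?thesis by simp
qed

lemma exp_taylor_odd:
  fixes x :: real
  assumes "odd n" "x \<le> 0"
  shows "exp x \<le> (\<Sum>m<n. x ^ m / fact m)"
proof -
  obtain t where "exp x = (\<Sum>m<n. x ^ m / fact m) + exp t / fact n * x ^ n"
    using Maclaurin_exp_le[of x n] by blast
  moreover have "exp t / fact n * x ^ n \<le> 0"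
    using assms by (intro mult_nonneg_nonpos) (auto simp: power_le_zero_eq odd_pos)
  ultimately show ?thesis by simp
qed

lemma even_six: "even (6::nat)" and odd_five: "odd (5::nat)" and odd_seven: "odd (7::nat)"
  by simp_all

lemma exp_taylor_nonneg:
  fixes x :: real
  assumes "0 \<le> x"
  shows "(\<Sum>m<n. x ^ m / fact m) \<le> exp x"
proof -
  obtain t where "exp x = (\<Sum>m<n. x ^ m / fact m) + exp t / fact n * x ^ n"
    using Maclaurin_exp_le[of x n] by blast
  then show ?thesis using assms by simp
qed

text \<open>The Lagrange remainder is at most 3 / 720 * x ^ 5, by exp t \<le> 3 and x ^ 6 \<le> x ^
  5, and 1 / 120 + 3 / 720 = 1 / 80.\<close>

lemma exp_upper_unit:
  fixes x :: real
  assumes "0 \<le> x" "x \<le> 1"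
  shows "exp x \<le> 1 + x + x ^ 2 / 2 + x ^ 3 / 6 + x ^ 4 / 24 + x ^ 5 / 80"
proof -
  obtain t where t: "\<bar>t\<bar> \<le> \<bar>x\<bar>" "exp x = (\<Sum>m<6. x ^ m / fact m) + exp t / fact 6 * x ^ 6"
    using Maclaurin_exp_le[of x 6] by blast
  have "exp t \<le> exp 1" using t(1) assms by simp
  also have "\<dots> \<le> 3" by (rule exp_le)
  finally have "exp t * x ^ 6 \<le> 3 * x ^ 5"
    using assms by (intro mult_mono power_decreasing) auto
  then show ?thesis using t(2) by (simp add: eval_nat_numeral fact_numeral field_simps)
qed

lemma inverse_e_bounds: "36787 / 100000 \<le> exp (- 1 :: real)" "exp (- 1 :: real) \<le> 36788 / 100000"
proof -
  have "271828 / 100000 \<le> exp (1::real)" "exp (1::real) \<le> 271829 / 100000"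
  proof -
    have "\<bar>exp 1 - 5837465777 / 2147483648\<bar> \<le> (1 / 1000000 :: real)"
      by (rule order_trans[OF e_approx_32]) simp
    then show "271828 / 100000 \<le> exp (1::real)" "exp (1::real) \<le> 271829 / 100000"
      unfolding abs_le_iff by simp_all
  qed
  then show "36787 / 100000 \<le> exp (- 1 :: real)" "exp (- 1 :: real) \<le> 36788 / 100000"
    by (simp_all add: exp_minus inverse_eq_divide field_simps)
qed

text \<open>The left side equals 2 / e * (exp x - exp (19 / 30 * x)) with 19 / 30 = 1 - 11 / 30. The
  coefficients are those of the Taylor bounds, rounded up.\<close>

lemma leaf_loss_bound:
  fixes x :: real
  assumes "0 \<le> x" "x \<le> 1"
  shows "2 * (1 - exp (- (11 / 30) * x)) * exp (- (1 - x))
    \<le> x * (2698 / 10000 + 2204 / 10000 * x + 915 / 10000 * x ^ 2 + 258 / 10000 * x ^ 3 + 92 / 10000 * x ^ 4)"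
proof -
  have low: "1 + 19 / 30 * x + (19 / 30 * x) ^ 2 / 2 + (19 / 30 * x) ^ 3 / 6 + (19 / 30 * x) ^ 4 / 24 \<le> exp (19 / 30 * x)"
    using exp_taylor_nonneg[of "19 / 30 * x" 5] assms by (simp add: eval_nat_numeral fact_numeral)
  have "exp (- (11 / 30) * x) * exp x = exp (19 / 30 * x)" by (simp add: exp_add[symmetric])
  moreover have "exp (- (1 - x)) = exp (- 1) * exp x" by (simp add: exp_add[symmetric])
  ultimately have "2 * (1 - exp (- (11 / 30) * x)) * exp (- (1 - x)) = 2 * exp (- 1) * (exp x - exp (19 / 30 * x))"
    by (simp add: algebra_simps)
  also have "\<dots> \<le> 2 * (36788 / 100000) * (exp x - exp (19 / 30 * x))"
    using inverse_e_bounds assms by (intro mult_right_mono) auto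
  also have "\<dots> \<le> 2 * (36788 / 100000) * (1 + x + x ^ 2 / 2 + x ^ 3 / 6 + x ^ 4 / 24 + x ^ 5 / 80
      - (1 + 19 / 30 * x + (19 / 30 * x) ^ 2 / 2 + (19 / 30 * x) ^ 3 / 6 + (19 / 30 * x) ^ 4 / 24))"
    using exp_upper_unit[OF assms] low by (intro mult_left_mono) auto
  also have "\<dots> = 2 * (36788 / 100000) * (x * (11 / 30) + x ^ 2 * (539 / 1800) + x ^ 3 * (20141 / 162000)
      + x ^ 4 * (679679 / 19440000) + x ^ 5 / 80)"
    by (simp add: field_simps power_divide power_mult_distrib)
  also have "\<dots> \<le> x * (2698 / 10000) + x ^ 2 * (2204 / 10000) + x ^ 3 * (915 / 10000) + x ^ 4 * (258 / 10000) + x ^ 5 * (92 / 10000)"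
  proof -
    have "0 \<le> x ^ 2" "0 \<le> x ^ 3" "0 \<le> x ^ 4" "0 \<le> x ^ 5" using assms by auto
    with assms show ?thesis unfolding distrib_left by linarith
  qed
  finally show ?thesis by (simp add: algebra_simps eval_nat_numeral)
qed

text \<open>The right side equals (exp (2 * x) - exp x) / e ^ 2; the coefficients are rounded
  down.\<close>

lemma isolated_gain_bound:
  fixes x :: real
  assumes "0 \<le> x" "x \<le> 1"
  shows "x * (1353 / 10000 + 2029 / 10000 * x + 1578 / 10000 * x ^ 2 + 845 / 10000 * x ^ 3 + 343 / 10000 * x ^ 4)
    \<le> (1 - exp (- x)) * (exp (- (1 - x)))\<^sup>2"
proof -
  have low: "1 + 2 * x + (2 * x) ^ 2 / 2 + (2 * x) ^ 3 / 6 + (2 * x) ^ 4 / 24 + (2 * x) ^ 5 / 120 \<le> exp (2 * x)"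
    using exp_taylor_nonneg[of "2 * x" 6] assms by (simp add: eval_nat_numeral fact_numeral)
  have "x * (1353 / 10000 + 2029 / 10000 * x + 1578 / 10000 * x ^ 2 + 845 / 10000 * x ^ 3 + 343 / 10000 * x ^ 4)
     = x * (1353 / 10000) + x ^ 2 * (2029 / 10000) + x ^ 3 * (1578 / 10000) + x ^ 4 * (845 / 10000) + x ^ 5 * (343 / 10000)"
    by (simp add: algebra_simps eval_nat_numeral)
  also have "\<dots> \<le> (36787 / 100000)\<^sup>2 * (x + x ^ 2 * (3 / 2) + x ^ 3 * (7 / 6) + x ^ 4 * (5 / 8) + x ^ 5 * (61 / 240))"
  proof -
    have "0 \<le> x ^ 2" "0 \<le> x ^ 3" "0 \<le> x ^ 4" "0 \<le> x ^ 5" using assms by auto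
    with assms have "x * (1353 / 10000) + x ^ 2 * (2029 / 10000) + x ^ 3 * (1578 / 10000) + x ^ 4 * (845 / 10000) + x ^ 5 * (343 / 10000)
        \<le> 1353283 / 10000000 * (x + x ^ 2 * (3 / 2) + x ^ 3 * (7 / 6) + x ^ 4 * (5 / 8) + x ^ 5 * (61 / 240))"
      unfolding distrib_left by linarith
    also have "\<dots> \<le> (36787 / 100000)\<^sup>2 * (x + x ^ 2 * (3 / 2) + x ^ 3 * (7 / 6) + x ^ 4 * (5 / 8) + x ^ 5 * (61 / 240))"
      using assms by (intro mult_right_mono) (simp_all add: power2_eq_square)
    finally show ?thesis .
  qed
  also have "\<dots> = (36787 / 100000)\<^sup>2 * (1 + 2 * x + (2 * x) ^ 2 / 2 + (2 * x) ^ 3 / 6 + (2 * x) ^ 4 / 24 + (2 * x) ^ 5 / 120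
      - (1 + x + x ^ 2 / 2 + x ^ 3 / 6 + x ^ 4 / 24 + x ^ 5 / 80))"
    by (simp add: power_mult_distrib)
  also have "\<dots> \<le> (36787 / 100000)\<^sup>2 * (exp (2 * x) - exp x)"
    using exp_upper_unit[OF assms] low by (intro mult_left_mono) auto
  also have "\<dots> \<le> (exp (- 1))\<^sup>2 * (exp (2 * x) - exp x)"
    using inverse_e_bounds assms by (intro mult_right_mono power_mono) auto
  also have "\<dots> = (1 - exp (- x)) * (exp (- (1 - x)))\<^sup>2"
    by (simp add: power2_eq_square algebra_simps exp_add[symmetric])
  finally show ?thesis .
qed

text \<open>Here 26 / 45 = (1 + 2 * (11 / 30)) / 3. The linear factor is nearly tangent to the
  quotient by s at s = 2 / 3, that is x = 1 / 3, where the final inequality has least room.\<close>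

lemma late_gap_bound:
  fixes s :: real
  assumes "0 \<le> s" "s \<le> 1"
  shows "s * (379 / 1000 - 194 / 1000 * s) \<le> exp (- (26 / 45) * s) - exp (- s)"
proof -
  have 1: "1 - 26 / 45 * s + (26 / 45 * s) ^ 2 / 2 - (26 / 45 * s) ^ 3 / 6 + (26 / 45 * s) ^ 4 / 24 - (26 / 45 * s) ^ 5 / 120
      \<le> exp (- (26 / 45) * s)"
    using exp_taylor_even[OF even_six, of "- (26 / 45) * s"] by (simp add: eval_nat_numeral fact_numeral)
  have 2: "exp (- s) \<le> 1 - s + s ^ 2 / 2 - s ^ 3 / 6 + s ^ 4 / 24 - s ^ 5 / 120 + s ^ 6 / 720"
    using exp_taylor_odd[OF odd_seven, of "- s"] assms by (simp add: eval_nat_numeral fact_numeral)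
  \<comment> \<open>The Taylor difference divided by s, with coefficients rounded down. Its minimum
    lies near s = 2 / 3, so squares centred nearby certify the sign by linear arithmetic.\<close>
  have "0 \<le> 432 / 10000 - 1391 / 10000 * s + 1345 / 10000 * s ^ 2 - 371 / 10000 * s ^ 3 + 77 / 10000 * s ^ 4 - 14 / 10000 * s ^ 5"
  proof -
    have "0 \<le> s ^ 4 * (1 - s)" "0 \<le> s ^ 2 * (s - 2 / 3) ^ 2" "0 \<le> (1 - s) * (s - 2 / 3) ^ 2"
      "0 \<le> (s - 68 / 100) ^ 2" "0 \<le> s ^ 4"
      using assms by (auto intro!: mult_nonneg_nonneg)
    moreover have "s ^ 4 * (1 - s) = s ^ 4 - s ^ 5"
      "s ^ 2 * (s - 2 / 3) ^ 2 = s ^ 4 - 4 / 3 * s ^ 3 + 4 / 9 * s ^ 2"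
      "(1 - s) * (s - 2 / 3) ^ 2 = 4 / 9 - 16 / 9 * s + 7 / 3 * s ^ 2 - s ^ 3"
      "(s - 68 / 100) ^ 2 = s ^ 2 - 136 / 100 * s + 4624 / 10000"
      by algebra+
    ultimately show ?thesis using assms by linarith
  qed
  then have "0 \<le> s * (432 / 10000 - 1391 / 10000 * s + 1345 / 10000 * s ^ 2 - 371 / 10000 * s ^ 3 + 77 / 10000 * s ^ 4 - 14 / 10000 * s ^ 5)"
    using assms by simp
  also have "\<dots> = s * (432 / 10000) - s ^ 2 * (1391 / 10000) + s ^ 3 * (1345 / 10000) - s ^ 4 * (371 / 10000) + s ^ 5 * (77 / 10000) - s ^ 6 * (14 / 10000)"
    by (simp add: algebra_simps eval_nat_numeral)
  finally have "0 \<le> s * (432 / 10000) - s ^ 2 * (1391 / 10000) + s ^ 3 * (1345 / 10000) - s ^ 4 * (371 / 10000) + s ^ 5 * (77 / 10000) - s ^ 6 * (14 / 10000)" .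
  moreover have "0 \<le> s" "0 \<le> s ^ 2" "0 \<le> s ^ 3" "0 \<le> s ^ 4" "0 \<le> s ^ 5" "0 \<le> s ^ 6" using assms by auto
  moreover have "s * (379 / 1000 - 194 / 1000 * s) = s * (379 / 1000) - s ^ 2 * (194 / 1000)"
    by (simp add: algebra_simps power2_eq_square)
  moreover have "1 - 26 / 45 * s + 338 / 2025 * s ^ 2 - 8788 / 273375 * s ^ 3 + 57122 / 12301875 * s ^ 4
      - 1485172 / 2767921875 * s ^ 5 \<le> exp (- (26 / 45) * s)"
    using 1 by (simp add: power_divide power_mult_distrib)
  ultimately show ?thesis using 2 by linarith
qed

lemma balance_bound:
  fixes x :: real
  assumes x: "0 \<le> x" "x \<le> 1"
  shows "509 / 1000 * x \<le> 2 * x * (1 - exp (- (11 / 30))) - 2 * (1 - exp (- (11 / 30) * x)) * exp (- (1 - x))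
    + (1 - exp (- x)) * (exp (- (1 - x)))\<^sup>2
    + 9 / 8 * (1 - exp (- x)) * (exp (- (1 + 2 * (11 / 30)) / 3 * (1 - x)) - exp (- (1 - x)))\<^sup>2"
proof -
  have 1: "exp (- (11 / 30) :: real) \<le> 6931 / 10000"
    using exp_taylor_odd[OF odd_five, of "- (11 / 30)"] by (simp add: eval_nat_numeral fact_numeral)
  have "1 - exp (- x) \<ge> x * (1 - x / 2 + x ^ 2 / 6 - x ^ 3 / 24)"
    using exp_taylor_odd[OF odd_five, of "- x"] x by (simp add: eval_nat_numeral fact_numeral algebra_simps)
  moreover have "((1 - x) * (185 / 1000 + 194 / 1000 * x))\<^sup>2
      \<le> (exp (- (1 + 2 * (11 / 30)) / 3 * (1 - x)) - exp (- (1 - x)))\<^sup>2"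
  proof (intro power_mono mult_nonneg_nonneg)
    have "(1 - x) * (185 / 1000 + 194 / 1000 * x) = (1 - x) * (379 / 1000 - 194 / 1000 * (1 - x))"
      "- (1 + 2 * (11 / 30)) / 3 * (1 - x) = - (26 / 45) * (1 - x)" by algebra+
    then show "(1 - x) * (185 / 1000 + 194 / 1000 * x)
        \<le> exp (- (1 + 2 * (11 / 30)) / 3 * (1 - x)) - exp (- (1 - x))"
      using late_gap_bound[of "1 - x"] x by (simp only:)
  qed (use x in auto)
  ultimately have 2: "x * (1 - x / 2 + x ^ 2 / 6 - x ^ 3 / 24) * ((1 - x) * (185 / 1000 + 194 / 1000 * x))\<^sup>2
      \<le> (1 - exp (- x)) * (exp (- (1 + 2 * (11 / 30)) / 3 * (1 - x)) - exp (- (1 - x)))\<^sup>2"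
    using x by (intro mult_mono) auto
  \<comment> \<open>The coefficients of \<open>?r\<close> below, rounded down. The minimum, near x =
    1 / 3, is less than 0.001, which explains the centres of the squares.\<close>
  have poly: "0 \<le> 88 / 10000 - 331 / 10000 * x - 99 / 10000 * x ^ 2 + 941 / 10000 * x ^ 3 + 558 / 10000 * x ^ 4
      - 185 / 10000 * x ^ 5 + 72 / 10000 * x ^ 6 - 18 / 10000 * x ^ 7"
  proof -
    have "0 \<le> x ^ 4 * (1 - x)" "0 \<le> x ^ 6 * (1 - x)" "0 \<le> x ^ 2 * (x - 1 / 3) ^ 2" "0 \<le> x * (x - 1 / 3) ^ 2"
      "0 \<le> (x - 352 / 1000) ^ 2" "0 \<le> x ^ 4" "0 \<le> x ^ 6"
      using x by (auto intro!: mult_nonneg_nonneg)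
    moreover have "x ^ 4 * (1 - x) = x ^ 4 - x ^ 5" "x ^ 6 * (1 - x) = x ^ 6 - x ^ 7"
      "x ^ 2 * (x - 1 / 3) ^ 2 = x ^ 4 - 2 / 3 * x ^ 3 + 1 / 9 * x ^ 2"
      "x * (x - 1 / 3) ^ 2 = x ^ 3 - 2 / 3 * x ^ 2 + 1 / 9 * x"
      "(x - 352 / 1000) ^ 2 = x ^ 2 - 704 / 1000 * x + 123904 / 1000000"
      by algebra+
    ultimately show ?thesis using x by linarith
  qed
  have "0 \<le> 2 * (1 - 6931 / 10000) - 509 / 1000
     - (2698 / 10000 + 2204 / 10000 * x + 915 / 10000 * x ^ 2 + 258 / 10000 * x ^ 3 + 92 / 10000 * x ^ 4)
     + (1353 / 10000 + 2029 / 10000 * x + 1578 / 10000 * x ^ 2 + 845 / 10000 * x ^ 3 + 343 / 10000 * x ^ 4)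
     + 9 / 8 * ((1 - x / 2 + x ^ 2 / 6 - x ^ 3 / 24) * ((1 - x) * (185 / 1000 + 194 / 1000 * x))\<^sup>2)"
    (is "0 \<le> ?r")
  proof -
    have "0 \<le> x ^ 2" "0 \<le> x ^ 3" "0 \<le> x ^ 4" "0 \<le> x ^ 5" "0 \<le> x ^ 6" "0 \<le> x ^ 7" using x by auto
    moreover have late: "9 / 8 * ((1 - x / 2 + x ^ 2 / 6 - x ^ 3 / 24) * ((1 - x) * (185 / 1000 + 194 / 1000 * x))\<^sup>2) =
      12321 / 320000 - 49617 / 3200000 * x - 1217877 / 16000000 * x ^ 2 + 90681 / 2560000 * x ^ 3 + 982563 / 32000000 * x ^ 4 - 1181703 / 64000000 * x ^ 5 + 115527 / 16000000 * x ^ 6 - 28227 / 16000000 * x ^ 7"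
      by (simp add: field_simps eval_nat_numeral)
    ultimately show ?thesis unfolding late using poly x by argo
  qed
  then have "0 \<le> x * ?r" using x by simp
  moreover have "x * (k - 509 / 1000 - a + b + 9 / 8 * c) = k * x - 509 / 1000 * x - x * a + x * b + 9 / 8 * (x * c)"
    for a b c k by algebra
  ultimately have "509 / 1000 * x \<le> 2 * (1 - 6931 / 10000) * x - 2 * (1 - exp (- (11 / 30) * x)) * exp (- (1 - x))
    + (1 - exp (- x)) * (exp (- (1 - x)))\<^sup>2
    + 9 / 8 * ((1 - exp (- x)) * (exp (- (1 + 2 * (11 / 30)) / 3 * (1 - x)) - exp (- (1 - x)))\<^sup>2)"
    using leaf_loss_bound[OF x] isolated_gain_bound[OF x] 2[unfolded mult.assoc] by (simp only:) argo
  moreover have "(1 - 6931 / 10000) * x \<le> (1 - exp (- (11 / 30))) * x" using 1 x by (intro mult_right_mono) auto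
  ultimately show ?thesis by argo
qed

subsection \<open>From matrices to bipartite graphs\<close>

lemma prob_map_pmf: "measure_pmf.prob (map_pmf f p) {y. Q y} = measure_pmf.prob p {x. Q (f x)}"
  by (simp add: vimage_def)

lemma prob_member_rset_pmf:
  assumes "finite I" "\<And>i. i \<in> I \<Longrightarrow> 0 \<le> p i \<and> p i \<le> 1" "e \<in> I"
  shows "measure_pmf.prob (rset_pmf I p) {R. e \<in> R} = p e"
proof -
  have "measure_pmf.prob (rset_pmf I p) {R. e \<in> R} = measure_pmf.expectation (rset_pmf I p) (\<lambda>R. of_bool (e \<in> R))"
  proof -
    have "(\<lambda>R. of_bool (e \<in> R)) = (indicator {R. e \<in> R} :: _ \<Rightarrow> real)" by (auto simp: indicator_def)
    then show ?thesis by simp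
  qed
  also have "\<dots> = bexp I p (\<lambda>R. of_bool ({e} \<subseteq> R \<and> R \<inter> {} = {}))"
    using assms by (simp add: expectation_rset_pmf)
  also have "\<dots> = p e" using assms by (subst bexp_cylinder) auto
  finally show ?thesis .
qed

lemma fractional_matching_degree:
  assumes "finite E" "fractional_matching E x"
  shows "(\<Sum>e\<in>{e \<in> E. v \<in> e}. x e) \<le> 1"
proof -
  obtain w where w: "\<forall>M\<in>matchings E. 0 \<le> w M" "(\<Sum>M\<in>matchings E. w M) = 1"
    "\<forall>e\<in>E. x e = (\<Sum>M\<in>matchings E. w M * indicator M e)"
    using assms(2) by (auto simp: fractional_matching_def matching_polytope_def)
  have one: "(\<Sum>e\<in>{e \<in> E. v \<in> e}. indicator M e) \<le> (1::real)" if M: "M \<in> matchings E" for M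
  proof -
    have "{e \<in> E. v \<in> e} \<inter> M = {e \<in> M. v \<in> e}" using M by (auto simp: matchings_def)
    then have "(\<Sum>e\<in>{e \<in> E. v \<in> e}. indicator M e) = real (card {e \<in> M. v \<in> e})"
      using assms(1) by (simp add: indicator_def sum.If_cases)
    moreover have "card {e \<in> M. v \<in> e} \<le> 1"
    proof -
      have "e = e'" if "e \<in> M" "e' \<in> M" "v \<in> e" "v \<in> e'" for e e'
        using that M by (auto simp: matchings_def pairwise_def disjnt_def)
      then show ?thesis using card_le_Suc0_iff_eq[of "{e \<in> M. v \<in> e}"] assms(1) M
        by (auto simp: matchings_def intro: finite_subset)
    qed
    ultimately show ?thesis by simp
  qed
  have "(\<Sum>e\<in>{e \<in> E. v \<in> e}. x e) = (\<Sum>e\<in>{e \<in> E. v \<in> e}. \<Sum>M\<in>matchings E. w M * indicator M e)"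
    using w(3) by (intro sum.cong) auto
  also have "\<dots> = (\<Sum>M\<in>matchings E. w M * (\<Sum>e\<in>{e \<in> E. v \<in> e}. indicator M e))"
    by (subst sum.swap) (simp add: sum_distrib_left)
  also have "\<dots> \<le> (\<Sum>M\<in>matchings E. w M * 1)"
    using w(1) one by (intro sum_mono mult_left_mono) auto
  finally show ?thesis using w(2) by simp
qed

text \<open>The selected set lies in R almost surely, so the joint event is just that e is selected;
  the condition has probability \<open>x e\<close>.\<close>

lemma balanced_if_prob:
  assumes fin: "finite E" and x: "\<And>e. e \<in> E \<Longrightarrow> 0 \<le> x e \<and> x e \<le> 1"
    and crs: "contention_resolution_scheme E \<phi>"
    and c: "\<And>e. e \<in> E \<Longrightarrow> c * x e \<le> measure_pmf.expectation (rset_pmf E x) (\<lambda>R. measure_pmf.prob (\<phi> R) {M. e \<in> M})"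
  shows "balanced c E x \<phi>"
  unfolding balanced_def
proof (intro ballI impI)
  fix e assume e: "e \<in> E" "0 < x e"
  let ?D = "crs_outcome E x \<phi>"
  have re: "random_edges E x = rset_pmf E x" by (simp add: random_edges_def rset_pmf_def)
  have "fst \<omega> \<subseteq> E \<and> snd \<omega> \<subseteq> fst \<omega>" if mem: "\<omega> \<in> set_pmf ?D" for \<omega>
  proof -
    obtain R M where "R \<in> set_pmf (rset_pmf E x)" "M \<in> set_pmf (\<phi> R)" and \<omega>: "\<omega> = (R, M)"
      using mem by (auto simp: crs_outcome_def re)
    then have "R \<subseteq> E" "M \<in> matchings R"
      using set_rset_pmf[of E x] crs unfolding contention_resolution_scheme_def by blast+
    then show ?thesis by (simp add: \<omega> matchings_def)
  qed
  then have "measure_pmf.prob ?D {\<omega>. e \<in> snd \<omega> \<and> e \<in> fst \<omega>} = measure_pmf.prob ?D {\<omega>. e \<in> snd \<omega>}"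
    by (intro measure_pmf.finite_measure_eq_AE) (auto simp: AE_measure_pmf_iff)
  also have "\<dots> = measure_pmf.expectation (rset_pmf E x) (\<lambda>R. measure_pmf.prob (\<phi> R) {M. e \<in> M})"
    unfolding crs_outcome_def re prob_bind_pmf prob_map_pmf by simp
  also have "\<dots> \<ge> c * x e" using c[OF e(1)] .
  finally have num: "c * x e \<le> measure_pmf.prob ?D {\<omega>. e \<in> snd \<omega> \<and> e \<in> fst \<omega>}" .
  have "measure_pmf.prob ?D {\<omega>. e \<in> fst \<omega>} = measure_pmf.prob (map_pmf fst ?D) {R. e \<in> R}"
    by (simp add: prob_map_pmf)
  also have "map_pmf fst ?D = rset_pmf E x"
    by (simp add: crs_outcome_def re map_bind_pmf map_pmf_comp bind_return_pmf')
  also have "measure_pmf.prob (rset_pmf E x) {R. e \<in> R} = x e"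
    using fin x e by (intro prob_member_rset_pmf) auto
  finally have "\<P>(\<omega> in measure_pmf ?D. e \<in> snd \<omega> \<bar> e \<in> fst \<omega>) =
      measure_pmf.prob ?D {\<omega>. e \<in> snd \<omega> \<and> e \<in> fst \<omega>} / x e"
    by (simp add: cond_prob_def)
  then show "c \<le> \<P>(\<omega> in measure_pmf ?D. e \<in> snd \<omega> \<bar> e \<in> fst \<omega>)"
    using num e(2) by (simp add: pos_le_divide_eq)
qed

text \<open>Symmetric on the vertex set: each edge occurs in both orientations, and the diagonal
  entry is the slack of the vertex.\<close>

definition loop_matrix :: "'a set set \<Rightarrow> ('a set \<Rightarrow> real) \<Rightarrow> 'a \<Rightarrow> 'a \<Rightarrow> real" where
  "loop_matrix E x i j =
    (if i = j then 1 - (\<Sum>e\<in>{e \<in> E. i \<in> e}. x e) else if {i, j} \<in> E then x {i, j} else 0)"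

lemma loop_matrix_sum:
  assumes "simple_graph V E" "i \<in> V"
  shows "(\<Sum>j\<in>V. loop_matrix E x i j) = 1"
proof -
  have V: "finite V" "\<And>e. e \<in> E \<Longrightarrow> e \<subseteq> V \<and> card e = 2" using assms by (auto simp: simple_graph_def)
  have "(\<Sum>j\<in>V - {i}. loop_matrix E x i j) = (\<Sum>j\<in>{j \<in> V - {i}. {i, j} \<in> E}. x {i, j})"
    using V by (intro sum.mono_neutral_cong_right) (auto simp: loop_matrix_def)
  also have "\<dots> = (\<Sum>e\<in>{e \<in> E. i \<in> e}. x e)"
  proof (rule sum.reindex_bij_betw)
    show "bij_betw (\<lambda>j. {i, j}) {j \<in> V - {i}. {i, j} \<in> E} {e \<in> E. i \<in> e}"
      unfolding bij_betw_def
    proof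
      show "inj_on (\<lambda>j. {i, j}) {j \<in> V - {i}. {i, j} \<in> E}" by (auto simp: inj_on_def doubleton_eq_iff)
      have "e \<in> (\<lambda>j. {i, j}) ` {j \<in> V - {i}. {i, j} \<in> E}" if e: "e \<in> E" "i \<in> e" for e
      proof -
        obtain a b where "e = {a, b}" "a \<noteq> b" using V(2)[OF e(1)] by (auto simp: card_2_iff)
        then obtain j where "e = {i, j}" "j \<noteq> i" using e(2) by auto
        then show ?thesis using e V(2)[OF e(1)] by auto
      qed
      then show "(\<lambda>j. {i, j}) ` {j \<in> V - {i}. {i, j} \<in> E} = {e \<in> E. i \<in> e}" by auto
    qed
  qed
  finally show ?thesis
    using sum.remove[OF V(1) assms(2), of "loop_matrix E x i"] by (simp add: loop_matrix_def)
qed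

lemma loop_matrix_sym: "loop_matrix E x i j = loop_matrix E x j i"
  by (simp add: loop_matrix_def insert_commute)

theorem theorem2:
  fixes V :: "'a set" and E :: "'a set set" and x :: "'a set \<Rightarrow> real"
  assumes "bipartite_graph V E"
    and "fractional_matching E x"
  shows "\<exists>\<phi>. contention_resolution_scheme E \<phi> \<and> balanced 0.509 E x \<phi>"
proof -
  have simple: "simple_graph V E" using assms(1) by (simp add: bipartite_graph_def)
  then have V: "finite V" "\<And>e. e \<in> E \<Longrightarrow> e \<subseteq> V \<and> card e = 2" by (auto simp: simple_graph_def)
  have finE: "finite E" using V by (auto intro: finite_subset[of E "Pow V"])
  obtain A B where AB: "A \<union> B = V" "A \<inter> B = {}" and parts: "\<forall>e\<in>E. \<exists>a\<in>A. \<exists>b\<in>B. e = {a, b}"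
    using assms(1) by (auto simp: bipartite_graph_def)
  have x: "0 \<le> x e \<and> x e \<le> 1" if "e \<in> E" for e
    using assms(2) that by (auto simp: fractional_matching_def)
  define X where "X = loop_matrix E x"
  \<comment> \<open>\<open>11 / 30\<close> is slightly below \<open>1 / e\<close>, the largest value for which the vetoes are probabilities.\<close>
  interpret leaf_scheme V V X "11 / 30"
  proof
    show "0 \<le> X i j" for i j
      using fractional_matching_degree[OF finE assms(2)] x by (simp add: X_def loop_matrix_def)
    show row: "(\<Sum>j\<in>V. X i j) = 1" if "i \<in> V" for i
      using loop_matrix_sum[OF simple that] by (simp add: X_def)
    show "(\<Sum>i\<in>V. X i j) = 1" if "j \<in> V" for j
    proof -
      have "(\<Sum>i\<in>V. X i j) = (\<Sum>i\<in>V. X j i)" unfolding X_def by (intro sum.cong refl loop_matrix_sym)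
      then show ?thesis using row[OF that] by simp
    qed
    show "11 / 30 * exp 1 \<le> (1 :: real)" using e_less_272 by simp
  qed (use V in auto)
  \<comment> \<open>Of the two copies of an edge only the one oriented from \<open>A\<close> to
    \<open>B\<close> stands for the real edge. Reversed copies, loops and vetoes are simulated by
    independent coins, and matched pairs outside \<open>D\<close> are discarded.\<close>
  define D :: "('a, 'a) idx set" where "D = {(0, i, j) | i j. i \<in> A \<and> j \<in> B \<and> {i, j} \<in> E}"
  define h :: "('a, 'a) idx \<Rightarrow> 'a set" where "h n = (case n of (k, i, j) \<Rightarrow> {i, j})" for n
  have inj: "inj_on h D"
  proof (rule inj_onI)
    fix m n assume "m \<in> D" "n \<in> D" and eq: "h m = h n"
    then obtain i j i' j' where m: "m = (0, i, j)" "i \<in> A" "j \<in> B" and n: "n = (0, i', j')" "i' \<in> A" "j' \<in> B"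
      by (auto simp: D_def)
    have "{i, j} = {i', j'}" using eq by (simp add: m(1) n(1) h_def)
    then show "m = n" using m n AB(2) by (auto simp: doubleton_eq_iff)
  qed
  have hD: "h ` D = E"
  proof (intro equalityI subsetI)
    fix e assume "e \<in> E"
    then obtain a b where "a \<in> A" "b \<in> B" "e = {a, b}" using parts by blast
    then show "e \<in> h ` D" using \<open>e \<in> E\<close> by (intro image_eqI[of _ _ "(0, a, b)"]) (auto simp: h_def D_def)
  qed (auto simp: h_def D_def)
  define g where "g = inv_into D h"
  have gE: "g ` E = D" and hg: "\<And>e. e \<in> E \<Longrightarrow> h (g e) = e" and injg: "inj_on g E"
    using inj hD by (auto simp: g_def f_inv_into_f inj_on_inv_into)
  have Didx: "D \<subseteq> idx" using AB(1) by (auto simp: D_def idx_def)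
  have wtD: "wt n = 1 - exp (- x (h n))" if nD: "n \<in> D" for n
  proof -
    obtain i j where n: "n = (0, i, j)" "i \<in> A" "j \<in> B" "{i, j} \<in> E" using nD by (auto simp: D_def)
    then have "X i j = x {i, j}" using AB(2) by (auto simp: X_def loop_matrix_def)
    then show ?thesis by (simp add: n(1) h_def)
  qed
  \<comment> \<open>On \<open>D\<close> this is the thinning probability that turns \<open>x\<close>
    into \<open>1 - exp (- x)\<close>. If \<open>x (h n) = 0\<close>, division by zero gives 0,
    consistent with \<open>wt n = 0\<close>.\<close>
  define t where "t n = (if n \<in> D then wt n / x (h n) else wt n)" for n
  have t: "0 \<le> t n \<and> t n \<le> 1" if "n \<in> idx" for n
  proof (cases "n \<in> D")
    case True
    then have "0 \<le> x (h n)" using x hD by auto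
    moreover have "1 - exp (- x (h n)) \<le> x (h n)" using exp_ge_add_one_self[of "- x (h n)"] by simp
    ultimately show ?thesis using True wtD by (cases "x (h n) = 0") (auto simp: t_def divide_le_eq_1)
  next
    case False
    then show ?thesis using wt_bounds[OF that] by (simp add: t_def)
  qed
  have "\<exists>\<mu>. (\<forall>M\<in>set_pmf \<mu>. bimatching M \<and> M \<subseteq> support V V (alloc S)) \<and>
      (\<forall>i\<in>V. \<forall>j\<in>V. measure_pmf.prob \<mu> {M. (i, j) \<in> M} = alloc S i j)" for S
    by (intro birkhoff_substochastic substochastic_alloc V)
  then obtain \<mu> where \<mu>: "\<And>S M. M \<in> set_pmf (\<mu> S) \<Longrightarrow> bimatching M \<and> M \<subseteq> support V V (alloc S)"
    "\<And>S i j. i \<in> V \<Longrightarrow> j \<in> V \<Longrightarrow> measure_pmf.prob (\<mu> S) {M. (i, j) \<in> M} = alloc S i j"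
    by metis
  define edges where "edges M = {{i, j} | i j. (i, j) \<in> M \<and> (0, i, j) \<in> D}" for M
  \<comment> \<open>A coordinate of \<open>D\<close> needs both its edge in \<open>R\<close> and its
    coin in \<open>T\<close>; all others depend on the coin alone.\<close>
  define seen where "seen R T = T \<inter> (g ` R \<union> (idx - D))" for R T
  define \<phi> where "\<phi> R = bind_pmf (rset_pmf idx t) (\<lambda>T. map_pmf edges (\<mu> (seen R T)))" for R
  have crs: "contention_resolution_scheme E \<phi>"
    unfolding contention_resolution_scheme_def
  proof (intro allI impI subsetI)
    fix R F assume R: "R \<subseteq> E" and "F \<in> set_pmf (\<phi> R)"
    then obtain T M where M: "M \<in> set_pmf (\<mu> (seen R T))" "F = edges M" by (auto simp: \<phi>_def)
    note bm = \<mu>(1)[OF M(1)]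
    \<comment> \<open>A pair in the support of the allocation is a present entry, and on
      \<open>D\<close> presence requires the real edge.\<close>
    have present: "{i, j} \<in> R" if ij: "(i, j) \<in> M" "(0, i, j) \<in> D" for i j
    proof -
      have "i \<in> V" "j \<in> V" "alloc (seen R T) i j \<noteq> 0" using bm ij(1) by (auto simp: support_def)
      then have "(0, i, j) \<in> seen R T" using alloc_absent by blast
      then obtain e where "e \<in> R" "(0, i, j) = g e" using ij(2) by (auto simp: seen_def)
      then have "e = {i, j}" using hg[of e] R by (auto simp: h_def split: prod.splits)
      then show ?thesis using \<open>e \<in> R\<close> by simp
    qed
    have "disjnt {i, j} {i', j'}"
      if "(i, j) \<in> M" "(0, i, j) \<in> D" "(i', j') \<in> M" "(0, i', j') \<in> D" "{i, j} \<noteq> {i', j'}" for i j i' j'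
    proof -
      have "i \<in> A" "j \<in> B" "i' \<in> A" "j' \<in> B" using that by (auto simp: D_def)
      moreover have "inj_on fst M" "inj_on snd M" using bm by (auto simp: bimatching_def)
      then have "i \<noteq> i'" "j \<noteq> j'"
        using inj_onD[of fst M "(i, j)" "(i', j')"] inj_onD[of snd M "(i, j)" "(i', j')"] that(1,3,5) by auto
      ultimately show ?thesis using AB(2) by (auto simp: disjnt_def)
    qed
    then show "F \<in> matchings R"
      using present by (fastforce simp: matchings_def M(2) edges_def pairwise_def)
  qed
  have "509 / 1000 * x e \<le> measure_pmf.expectation (rset_pmf E x) (\<lambda>R. measure_pmf.prob (\<phi> R) {M. e \<in> M})"
    if e: "e \<in> E" for e
  proof -
    obtain a b where ab: "a \<in> A" "b \<in> B" "e = {a, b}" using parts e by blast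
    have abV: "a \<in> V" "b \<in> V" "a \<noteq> b" using ab AB by auto
    have Xab: "X a b = x e" using ab e abV by (simp add: X_def loop_matrix_def)
    have "e \<in> edges M \<longleftrightarrow> (a, b) \<in> M" for M
      using ab e AB(2) by (auto simp: edges_def D_def doubleton_eq_iff)
    then have "measure_pmf.prob (\<phi> R) {M. e \<in> M} = bexp idx t (\<lambda>T. alloc (seen R T) a b)" for R
      unfolding \<phi>_def prob_bind_pmf prob_map_pmf using \<mu>(2)[OF abV(1,2)] t
      by (simp add: expectation_rset_pmf)
    then have "measure_pmf.expectation (rset_pmf E x) (\<lambda>R. measure_pmf.prob (\<phi> R) {M. e \<in> M})
       = bexp E x (\<lambda>R. bexp idx t (\<lambda>T. alloc (seen R T) a b))"
      using finE x by (simp add: expectation_rset_pmf)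
    \<comment> \<open>Writing \<open>x\<close> through \<open>h\<close> and \<open>g\<close> moves
      the index set from edges to coordinates, where \<open>bexp_thin\<close> combines the edges
      with the coins.\<close>
    also have "\<dots> = bexp E ((x \<circ> h) \<circ> g) (\<lambda>R. bexp idx t (\<lambda>T. alloc (T \<inter> (g ` R \<union> (idx - D))) a b))"
      using hg by (intro bexp_cong refl) (simp_all add: seen_def)
    also have "\<dots> = bexp D (x \<circ> h) (\<lambda>R. bexp idx t (\<lambda>T. alloc (T \<inter> (R \<union> (idx - D))) a b))"
      using bexp_reindex[OF injg, of "x \<circ> h" "\<lambda>R. bexp idx t (\<lambda>T. alloc (T \<inter> (R \<union> (idx - D))) a b)"]
      by (simp only: gE)
    also have "\<dots> = bexp idx (\<lambda>n. if n \<in> D then (x \<circ> h) n * t n else t n) (\<lambda>S. alloc S a b)"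
      by (rule bexp_thin[OF fin_idx Didx])
    also have "\<dots> = bexp idx wt (\<lambda>S. alloc S a b)"
      using wtD by (intro bexp_cong refl) (auto simp: t_def)
    also have "\<dots> \<ge> 509 / 1000 * x e"
      using expectation_alloc[OF abV(1,2)] balance_bound[of "x e"] x[OF e] unfolding Xab by linarith
    finally show ?thesis .
  qed
  then have "balanced 0.509 E x \<phi>"
    using finE x crs by (intro balanced_if_prob) auto
  then show ?thesis using crs by blast
qed

end
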